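(* Let $n\ge7$ and let $(u_\lambda)$ be a family of least energy radial sign-changing solutions of $$-\Delta u=\lambda u+|u|^{2^*-2}u \ \text{ in } B_1,\qquad u=0\ \text{ on }\partial B_1,$$ with $u_\lambda(0)>0$. For every $\epsilon\in(0,\frac{n-2}{2})$ there exist $\delta=\delta(\epsilon)\in(0,1)$, with $\delta(\epsilon)\to1$ as $\epsilon\to0$, and a constant $\overline\lambda=\overline\lambda(\epsilon)>0$ such that for all $\lambda\in(0,\overline\lambda)$ $$u_\lambda^-(x)\le M_{\lambda,-}\left\{1+\frac{M_{\lambda,-}^{-1}f(M_{\lambda,-})}{n(n-2)}\,c(\epsilon)|x|^2\right\}^{-(n-2)/2}$$ for all $x\in A_{\delta,\lambda}:=\{x\in\mathbb{R}^n:\ \delta^{-1/n}s_\lambda<|x|<1\}$, where $c(\epsilon)=\frac{2}{n-2}\epsilon$, $s_\lambda$ is the global minimum point of $u_\lambda=u_\lambda(r)$, $M_{\lambda,-}=u_\lambda^-(s_\lambda)$, and $f:[0,+\infty)\to[0,+\infty)$ is $f(y):=\lambda y+y^{\frac{n+2}{n-2}}$.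
   Context: $B_1$ is the open unit ball of $\mathbb{R}^n$, $2^*=\frac{2n}{n-2}$, and $\lambda_1$ is the first Dirichlet eigenvalue of $-\Delta$ in $B_1$. A least energy radial sign-changing solution is a radial sign-changing solution minimizing $I_\lambda(u)=\frac12\int_{B_1}(|\nabla u|^2-\lambda u^2)\,dx-\frac1{2^*}\int_{B_1}|u|^{2^*}dx$ among all radial sign-changing solutions of the problem with parameter $\lambda$. The family consists of one such solution $u_\lambda$ for each $\lambda\in(0,\lambda_1)$. Solutions are classical; write $u_\lambda=u_\lambda(r)$, $r=|x|$. Each $u_\lambda$ has exactly two nodal regions: there is a node $r_\lambda\in(0,1)$ with $u_\lambda>0$ in $\{|x|<r_\lambda\}$ and $u_\lambda<0$ in $\{r_\lambda<|x|<1\}$. Moreover $u_\lambda^-=\max(-u_\lambda,0)$, and $s_\lambda\in(r_\lambda,1)$ is the radius at which $u_\lambda(r)$ attains its global minimum, so $M_{\lambda,-}=\|u_\lambda^-\|_\infty=u_\lambda^-(s_\lambda)$. *)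

theory Defs
  imports "HOL-Analysis.Analysis"
begin

definition partial_deriv :: "'a::euclidean_space \<Rightarrow> ('a \<Rightarrow> real) \<Rightarrow> 'a \<Rightarrow> real" where
  "partial_deriv b u x = frechet_derivative u (at x) b"

(* Intended for open S only, where differentiability within S at a point is
   differentiability at that point. *)
definition C2_on :: "'a::euclidean_space set \<Rightarrow> ('a \<Rightarrow> real) \<Rightarrow> bool" where
  "C2_on S u \<longleftrightarrow>
     u differentiable_on S \<and>
     (\<forall>b\<in>Basis. partial_deriv b u differentiable_on S) \<and>
     (\<forall>b\<in>Basis. \<forall>c\<in>Basis. continuous_on S (partial_deriv c (partial_deriv b u)))"

definition laplacian :: "('a::euclidean_space \<Rightarrow> real) \<Rightarrow> 'a \<Rightarrow> real" where
  "laplacian u x = (\<Sum>b\<in>Basis. partial_deriv b (partial_deriv b u) x)"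

definition grad_sq :: "('a::euclidean_space \<Rightarrow> real) \<Rightarrow> 'a \<Rightarrow> real" where
  "grad_sq u x = (\<Sum>b\<in>Basis. (partial_deriv b u x)\<^sup>2)"

(* Functions on the closed unit ball are total functions on the whole space; the
   values outside the closed ball are irrelevant to every notion below. *)
definition dirichlet_C2 :: "('a::euclidean_space \<Rightarrow> real) \<Rightarrow> bool" where
  "dirichlet_C2 u \<longleftrightarrow>
     C2_on (ball 0 1) u \<and> continuous_on (cball 0 1) u \<and> (\<forall>x\<in>sphere 0 1. u x = 0)"

definition dirichlet_eigenvalue :: "'a::euclidean_space itself \<Rightarrow> real \<Rightarrow> bool" where
  "dirichlet_eigenvalue TYPE('a) \<mu> \<longleftrightarrow>
     (\<exists>\<phi>::'a \<Rightarrow> real. dirichlet_C2 \<phi> \<and> (\<exists>x\<in>ball 0 1. \<phi> x \<noteq> 0) \<and>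
        (\<forall>x\<in>ball 0 1. - laplacian \<phi> x = \<mu> * \<phi> x))"

definition first_eigenvalue :: "'a::euclidean_space itself \<Rightarrow> real" where
  "first_eigenvalue TYPE('a) = Inf {\<mu>. dirichlet_eigenvalue TYPE('a) \<mu>}"

definition crit_exp :: "nat \<Rightarrow> real" where
  "crit_exp n = 2 * real n / (real n - 2)"

definition bn_solution :: "real \<Rightarrow> ('a::euclidean_space \<Rightarrow> real) \<Rightarrow> bool" where
  "bn_solution lam u \<longleftrightarrow>
     dirichlet_C2 u \<and>
     (\<forall>x\<in>ball 0 1. - laplacian u x
        = lam * u x + \<bar>u x\<bar> powr (crit_exp DIM('a) - 2) * u x)"

definition radial :: "('a::euclidean_space \<Rightarrow> real) \<Rightarrow> bool" where
  "radial u \<longleftrightarrow> (\<forall>x\<in>cball 0 1. \<forall>y\<in>cball 0 1. norm x = norm y \<longrightarrow> u x = u y)"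

definition sign_changing :: "('a::euclidean_space \<Rightarrow> real) \<Rightarrow> bool" where
  "sign_changing u \<longleftrightarrow> (\<exists>x\<in>ball 0 1. u x > 0) \<and> (\<exists>x\<in>ball 0 1. u x < 0)"

definition energy :: "real \<Rightarrow> ('a::euclidean_space \<Rightarrow> real) \<Rightarrow> real" where
  "energy lam u =
     1 / 2 * (LINT x:ball 0 1|lborel. grad_sq u x - lam * (u x)\<^sup>2)
     - 1 / crit_exp DIM('a) * (LINT x:ball 0 1|lborel. \<bar>u x\<bar> powr crit_exp DIM('a))"

definition radial_sc_solution :: "real \<Rightarrow> ('a::euclidean_space \<Rightarrow> real) \<Rightarrow> bool" where
  "radial_sc_solution lam u \<longleftrightarrow> bn_solution lam u \<and> radial u \<and> sign_changing u"

definition least_energy_radial_sc :: "real \<Rightarrow> ('a::euclidean_space \<Rightarrow> real) \<Rightarrow> bool" where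
  "least_energy_radial_sc lam u \<longleftrightarrow>
     radial_sc_solution lam u \<and>
     (\<forall>v::'a \<Rightarrow> real. radial_sc_solution lam v \<longrightarrow> energy lam u \<le> energy lam v)"

(* For radial u and r in [0,1] this is the value u(r); it is unspecified otherwise. *)
definition profile :: "('a::euclidean_space \<Rightarrow> real) \<Rightarrow> real \<Rightarrow> real" where
  "profile u r = (THE c. \<forall>x. norm x = r \<longrightarrow> u x = c)"

definition neg_part :: "('b \<Rightarrow> real) \<Rightarrow> 'b \<Rightarrow> real" where
  "neg_part u x = max (- u x) 0"

definition bn_f :: "nat \<Rightarrow> real \<Rightarrow> real \<Rightarrow> real" where
  "bn_f n lam y = lam * y + y powr ((real n + 2) / (real n - 2))"

end

theory Submission
  imports Defs
begin

text \<open>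
  Along a ray the solution satisfies a radial Lane-Emden type equation. Write \<open>m = (n - 2) / 2\<close>,
  \<open>v = - u\<close> on \<open>[s, 1)\<close>, \<open>M = v s\<close> and
  \<open>w = (v / M) powr (- 1 / m)\<close>; the claim is \<open>w \<ge> 1 + a c r\<^sup>2\<close> with \<open>a = f M / (M n (n - 2))\<close>. A Pohozaev
  function, which increases on \<open>[s, 1)\<close>, shows that \<open>w\<close> is a convex function of \<open>r\<^sup>2\<close>. Since
  \<open>w s = 1\<close> and \<open>w' s = 0\<close>, the quotient \<open>(w - 1) / r\<^sup>2\<close> increases, so the claim need only be checked at
  \<open>r = s / \<sigma>\<close>, where \<open>\<sigma> = \<delta> powr (1 / n)\<close>. There it follows from the crude estimate
  \<open>r^(n - 1) v' \<le> - f v (r^n - s^n) / n\<close>, provided \<open>a s\<^sup>2\<close> is small; writing \<open>c = t^4\<close>, the choice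
  \<open>\<sigma> = 1 - t\<close> works.

  Smallness of \<open>a s\<^sup>2\<close> as \<open>\<lambda> \<rightarrow> 0\<close> is the Pohozaev identity: up to a constant \<open>s^n M^(2 n / (n - 2))\<close> is the
  Pohozaev function at \<open>s\<close>, the part of its growth coming from \<open>[r\<^sub>\<lambda>, s]\<close> is absorbed, and on
  \<open>[0, r\<^sub>\<lambda>]\<close> it grows by at most \<open>C \<lambda>\<close>, because the crude estimate bounds \<open>r^(n - 2) u\<^sup>2\<close> there. Finally
  \<open>\<lambda>\<^sub>1 > 0\<close>, which makes the range of \<open>\<lambda>\<close> nonempty, needs the existence of some Dirichlet eigenvalue and a
  positive lower bound for all of them.
\<close>

section \<open>The radial equation\<close>

text \<open>Positivity is built in because \<open>powr\<close> is smooth only at positive bases.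
  Carrying \<open>v'\<close> as a separate function lets \<open>u\<close> inside the node and
  \<open>- u\<close> outside it be instances of one notion.\<close>

definition radial_pos_solution ::
    "nat \<Rightarrow> real \<Rightarrow> real set \<Rightarrow> (real \<Rightarrow> real) \<Rightarrow> (real \<Rightarrow> real) \<Rightarrow> bool" where
  "radial_pos_solution n lam I v v' \<longleftrightarrow>
     (\<forall>r\<in>I. 0 < r \<and> 0 < v r \<and> (v has_real_derivative v' r) (at r) \<and>
        (v' has_real_derivative - ((real n - 1) / r * v' r + bn_f n lam (v r))) (at r))"

text \<open>The Pohozaev function of the full equation is this expression plus \<open>lam r^n v\<^sup>2 / n\<close>. Without
  that term its sign is the one needed for convexity, and it increases wherever \<open>v\<close> decreases.\<close>

definition pohozaev :: "nat \<Rightarrow> real \<Rightarrow> (real \<Rightarrow> real) \<Rightarrow> (real \<Rightarrow> real) \<Rightarrow> real \<Rightarrow> real" where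
  "pohozaev n lam v v' r =
     r ^ n * (v' r)\<^sup>2 / 2 + (real n - 2) / 2 * r ^ (n - 1) * v r * v' r
     + (real n - 2) / (2 * real n) * r ^ n * v r * bn_f n lam (v r)"

text \<open>Only continuity is asked at the endpoints, such as the centre and the node, where the
  radial equation is singular or positivity fails.\<close>

lemma nonneg_deriv_imp_le:
  fixes f :: "real \<Rightarrow> real"
  assumes "a \<le> b" "\<And>x. \<lbrakk>a < x; x < b\<rbrakk> \<Longrightarrow> \<exists>y. DERIV f x :> y \<and> 0 \<le> y"
    and "continuous_on {a..b} f"
  shows "f a \<le> f b"
proof (cases "a = b")
  case False
  then have "a < b" using assms(1) by simp
  then obtain l z where z: "a < z" "z < b" "DERIV f z :> l" "f b - f a = (b - a) * l"
    using MVT[of a b f] assms(2,3) by (metis real_differentiable_def)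
  moreover have "l \<ge> 0" using assms(2)[OF z(1,2)] z(3) DERIV_unique by blast
  ultimately have "f b - f a \<ge> 0" using \<open>a < b\<close> by simp
  then show ?thesis by simp
qed simp

lemma nonpos_deriv_imp_ge:
  fixes f :: "real \<Rightarrow> real"
  assumes "a \<le> b" "\<And>x. \<lbrakk>a < x; x < b\<rbrakk> \<Longrightarrow> \<exists>y. DERIV f x :> y \<and> y \<le> 0"
    and "continuous_on {a..b} f"
  shows "f b \<le> f a"
proof -
  have "- f a \<le> - f b"
  proof (rule nonneg_deriv_imp_le[where f = "\<lambda>x. - f x"])
    fix x assume "a < x" "x < b"
    then obtain y where "DERIV f x :> y" "y \<le> 0" using assms(2) by blast
    then show "\<exists>y. ((\<lambda>x. - f x) has_real_derivative y) (at x) \<and> 0 \<le> y"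
      using DERIV_minus by fastforce
  qed (use assms in \<open>auto intro!: continuous_intros\<close>)
  then show ?thesis by simp
qed

section \<open>The nonlinearity and the derivative of the Pohozaev function\<close>

lemma bn_f_altdef:
  assumes "n \<ge> 3" "y \<ge> 0"
  shows "bn_f n lam y = y * (lam + y powr (4 / (real n - 2)))"
proof -
  have "(real n + 2) / (real n - 2) = 1 + 4 / (real n - 2)"
    using assms(1) by (simp add: field_simps)
  then show ?thesis
    using assms(2) powr_mult_base[of y "4 / (real n - 2)"] by (simp add: bn_f_def algebra_simps)
qed

lemma bn_f_mono:
  assumes "n \<ge> 3" "lam \<ge> 0" "0 \<le> x" "x \<le> y"
  shows "bn_f n lam x \<le> bn_f n lam y"
  unfolding bn_f_def using assms by (intro add_mono mult_left_mono powr_mono2) auto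

lemma bn_f_nonneg: "\<lbrakk>lam \<ge> 0; y \<ge> 0\<rbrakk> \<Longrightarrow> bn_f n lam y \<ge> 0"
  by (simp add: bn_f_def)

lemma continuous_on_bn_f [continuous_intros]:
  assumes "n \<ge> 3" "continuous_on S v" "\<And>r. r \<in> S \<Longrightarrow> v r \<ge> 0"
  shows "continuous_on S (\<lambda>r. bn_f n lam (v r))"
  unfolding bn_f_def using assms by (intro continuous_intros continuous_on_powr') auto

lemma bn_f_deriv:
  assumes "n \<ge> 3" "y > 0"
  shows "(bn_f n lam has_real_derivative lam + (real n + 2) / (real n - 2) * y powr (4 / (real n - 2))) (at y)"
proof -
  have "(real n + 2) / (real n - 2) - 1 = 4 / (real n - 2)"
    using assms(1) by (simp add: field_simps)
  then show ?thesis
    unfolding bn_f_def[abs_def] using assms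
    by (auto intro!: derivative_eq_intros)
qed

text \<open>The weight \<open>(n - 2) / 2\<close> cancels the terms in
  \<open>(v' r)\<^sup>2\<close>, and criticality of the exponent cancels the pure powers of
  \<open>v\<close>; only the linear part \<open>lam * v\<close> leaves a remainder.\<close>

lemma pohozaev_deriv:
  assumes n: "n \<ge> 3" and sol: "radial_pos_solution n lam I v v'" and r: "r \<in> I"
  shows "(pohozaev n lam v v' has_real_derivative - (2 * lam / real n) * r ^ n * v r * v' r) (at r)"
proof -
  \<comment> \<open>Writing \<open>n\<close> as \<open>Suc (Suc k)\<close> removes truncated
    subtraction, so all powers of \<open>r\<close> reduce to \<open>r ^ k\<close>.\<close>
  define k where "k = n - 2"
  have k: "n = Suc (Suc k)" using n by (simp add: k_def)
  have k0: "real k > 0" using n k by simp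
  note * = sol[unfolded radial_pos_solution_def, rule_format, OF r]
  have r0: "r > 0" and v0: "v r > 0" using * by auto
  define y where "y = v r powr (4 / (real n - 2))"
  have f: "bn_f n lam (v r) = v r * (lam + y)"
    using bn_f_altdef[of n "v r" lam] n v0 by (simp add: y_def)
  have df: "((\<lambda>r. bn_f n lam (v r)) has_real_derivative
        (lam + (real n + 2) / (real n - 2) * y) * v' r) (at r)"
    using DERIV_chain2[where f = "bn_f n lam" and g = v, OF bn_f_deriv[OF n v0, of lam]] * by (simp add: y_def)
  have rk: "r ^ n = r * (r * r ^ k)" "r ^ (n - 1) = r * r ^ k" by (simp_all add: k)
  have "((\<lambda>r. r ^ n) has_real_derivative real n * (r * r ^ k)) (at r)"
    "((\<lambda>r. r ^ (n - 1)) has_real_derivative (real n - 1) * r ^ k) (at r)"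
    using DERIV_pow[of n r] DERIV_pow[of "n - 1" r] by (simp_all add: k)
  note D = this
  have dv: "(v has_real_derivative v' r) (at r)"
    and dv': "(v' has_real_derivative - ((real n - 1) / r * v' r + v r * (lam + y))) (at r)"
    using * f by auto
  have nz: "(2::real) \<noteq> 0" by simp
  show ?thesis
    unfolding pohozaev_def[abs_def]
    apply (rule D dv dv' df derivative_eq_intros refl nz)+
    unfolding rk f using r0 k0
    apply (simp add: k divide_simps)
    apply (simp add: algebra_simps power2_eq_square)
    done
qed

text \<open>The weight \<open>r ^ (n - 1)\<close> absorbs the first-order term; this is the
  divergence form of the equation.\<close>

lemma radial_flux_deriv:
  assumes n: "n \<ge> 3" and sol: "radial_pos_solution n lam I v v'" and r: "r \<in> I"
  shows "((\<lambda>r. r ^ (n - 1) * v' r) has_real_derivative - (r ^ (n - 1) * bn_f n lam (v r))) (at r)"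
proof -
  define k where "k = n - 2"
  have k: "n = Suc (Suc k)" using n by (simp add: k_def)
  note * = sol[unfolded radial_pos_solution_def, rule_format, OF r]
  have dv': "(v' has_real_derivative - ((real n - 1) / r * v' r + bn_f n lam (v r))) (at r)"
    and r0: "r > 0" using * by auto
  have D: "((\<lambda>r. r ^ (n - 1)) has_real_derivative (real n - 1) * r ^ k) (at r)"
    using DERIV_pow[of "n - 1" r] by (simp add: k)
  have rk: "r ^ (n - 1) = r * r ^ k" by (simp add: k)
  show ?thesis
    apply (rule D dv' derivative_eq_intros refl)+
    unfolding rk using r0 by (simp add: field_simps)
qed

section \<open>Decay of a radial solution away from a point of zero flux\<close>

text \<open>\<open>flux0\<close> is a product so as to cover both uses: \<open>a = 0\<close>, where
  the power vanishes, and \<open>a = s\<close>, where \<open>v'\<close> vanishes. The end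
  \<open>b\<close> is excluded because \<open>v\<close> may reach zero there.\<close>

locale radial_decreasing_solution =
  fixes n :: nat and lam a b :: real and v v' :: "real \<Rightarrow> real"
  assumes n: "n \<ge> 3" and lam: "lam \<ge> 0" and a: "0 \<le> a"
    and sol: "radial_pos_solution n lam {a<..<b} v v'"
    and cont: "continuous_on {a..<b} v" "continuous_on {a..<b} v'"
    and flux0: "a ^ (n - 1) * v' a = 0"
begin

lemma cont_sub:
  assumes "r < b"
  shows "continuous_on {a..r} v" "continuous_on {a..r} v'"
  using assms by (auto intro: continuous_on_subset[OF cont(1)] continuous_on_subset[OF cont(2)])

lemma solD:
  assumes "r \<in> {a<..<b}"
  shows "r > 0" "v r > 0" "(v has_real_derivative v' r) (at r)"
    "(v' has_real_derivative - ((real n - 1) / r * v' r + bn_f n lam (v r))) (at r)"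
  using sol assms unfolding radial_pos_solution_def by auto

text \<open>The flux starts at zero and has a nonpositive derivative.\<close>

lemma deriv_nonpos:
  assumes r: "r \<in> {a<..<b}"
  shows "v' r \<le> 0"
proof -
  have "r ^ (n - 1) * v' r \<le> a ^ (n - 1) * v' a"
  proof (rule nonpos_deriv_imp_ge[where f = "\<lambda>r. r ^ (n - 1) * v' r"])
    fix x assume x: "a < x" "x < r"
    then have xI: "x \<in> {a<..<b}" using r by auto
    have "- (x ^ (n - 1) * bn_f n lam (v x)) \<le> 0"
      using solD[OF xI] lam by (simp add: bn_f_nonneg)
    then show "\<exists>y. ((\<lambda>r. r ^ (n - 1) * v' r) has_real_derivative y) (at x) \<and> y \<le> 0"
      using radial_flux_deriv[OF n sol xI] by blast
  qed (use r cont_sub in \<open>auto intro!: continuous_intros\<close>)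
  then have "r ^ (n - 1) * v' r \<le> 0" using flux0 by linarith
  then show ?thesis
    using zero_less_power[OF solD(1)[OF r], of "n - 1"] by (simp only: mult_le_0_iff) linarith
qed

lemma antimono:
  assumes "a \<le> x" "x \<le> y" "y < b"
  shows "v y \<le> v x"
proof (rule nonpos_deriv_imp_ge[where f = v])
  fix z assume "x < z" "z < y"
  then have "z \<in> {a<..<b}" using assms by auto
  then show "\<exists>d. (v has_real_derivative d) (at z) \<and> d \<le> 0"
    using solD deriv_nonpos by blast
qed (use assms in \<open>auto intro: continuous_on_subset[OF cont(1)]\<close>)

text \<open>On \<open>[a, r]\<close> the source \<open>bn_f n lam (v x)\<close> is at least its
  value at \<open>r\<close>, because \<open>v\<close> decreases; the bound is the divergence form
  integrated with that constant source.\<close>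

lemma flux_bound:
  assumes r: "r \<in> {a<..<b}"
  shows "r ^ (n - 1) * v' r \<le> - (bn_f n lam (v r) * (r ^ n - a ^ n) / real n)"
proof -
  define g where "g x = x ^ (n - 1) * v' x + bn_f n lam (v r) * (x ^ n - a ^ n) / real n" for x
  have n0: "real n \<noteq> 0" using n by simp
  have "g r \<le> g a"
  proof (rule nonpos_deriv_imp_ge[where f = g])
    fix x assume x: "a < x" "x < r"
    then have xI: "x \<in> {a<..<b}" using r by auto
    have "(g has_real_derivative
        - (x ^ (n - 1) * bn_f n lam (v x)) + bn_f n lam (v r) * x ^ (n - 1)) (at x)"
      unfolding g_def
      by (rule radial_flux_deriv[OF n sol xI] derivative_eq_intros refl n0)+ (use n in simp)
    moreover have "bn_f n lam (v r) \<le> bn_f n lam (v x)"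
      using x r antimono[of x r] solD[OF r] n lam by (intro bn_f_mono) auto
    then have "bn_f n lam (v r) * x ^ (n - 1) \<le> bn_f n lam (v x) * x ^ (n - 1)"
      using solD(1)[OF xI] by (intro mult_right_mono) auto
    then have "- (x ^ (n - 1) * bn_f n lam (v x)) + bn_f n lam (v r) * x ^ (n - 1) \<le> 0"
      by (simp add: mult.commute)
    ultimately show "\<exists>y. (g has_real_derivative y) (at x) \<and> y \<le> 0" by blast
  next
    show "continuous_on {a..r} g"
      unfolding g_def using r cont_sub n by (auto intro!: continuous_intros)
  qed (use r in auto)
  then show ?thesis using flux0 unfolding g_def by (simp del: One_nat_def mult_eq_0_iff)
qed

text \<open>With \<open>p = 1 + 4 / (n - 2)\<close>, the quotient of \<open>bn_f n lam y\<close> by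
  \<open>y powr p\<close> is \<open>1 + lam * y powr (1 - p)\<close>, which decreases in
  \<open>y\<close>; it is compared here at \<open>v r \<le> v a\<close>.\<close>

lemma ratio_le:
  assumes r: "a \<le> r" "r < b" and va: "v a > 0"
  shows "bn_f n lam (v a) / v a * v r powr ((real n + 2) / (real n - 2))
    \<le> bn_f n lam (v r) * v a powr (4 / (real n - 2))"
proof -
  define K where "K = 4 / (real n - 2)"
  have vr: "v r > 0" using r solD(2)[of r] va by (cases "r = a") auto
  have p: "(real n + 2) / (real n - 2) = 1 + K"
    using n by (simp add: field_simps K_def)
  have le: "v r powr K \<le> v a powr K"
    using antimono[of a r] r vr n by (intro powr_mono2) (auto simp: K_def)
  have "lam * v r powr K \<le> lam * v a powr K"
    using le lam by (rule mult_left_mono)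
  then have "v r * (lam * v r powr K) \<le> v r * (lam * v a powr K)"
    using vr by (rule mult_left_mono[OF _ less_imp_le])
  then have "(lam + v a powr K) * (v r * v r powr K) \<le> v r * (lam + v r powr K) * v a powr K"
    by (simp add: algebra_simps)
  moreover have "bn_f n lam (v a) / v a = lam + v a powr K"
    using va n by (simp add: bn_f_altdef K_def)
  ultimately show ?thesis
    unfolding p using vr n by (simp add: bn_f_altdef K_def powr_add)
qed

text \<open>Dividing \<open>flux_bound\<close> by \<open>v powr (1 + K)\<close>, with
  \<open>K = 4 / (n - 2)\<close>, and applying \<open>ratio_le\<close> gives an explicit lower bound
  for the derivative of \<open>v powr (- K)\<close>; the bracket is its integral. The exponent is
  twice that of \<open>w\<close>, so this is a bound on \<open>w\<^sup>2\<close>.\<close>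

lemma decay:
  assumes r: "r \<in> {a<..<b}" and va: "v a > 0"
  shows "(v r / v a) powr (- (4 / (real n - 2))) \<ge>
    1 + 4 / (real n * (real n - 2)) * (bn_f n lam (v a) / v a)
        * (r\<^sup>2 / 2 + a ^ n / ((real n - 2) * r ^ (n - 2)) - a\<^sup>2 / 2 - a\<^sup>2 / (real n - 2))"
proof -
  define K where "K = 4 / (real n - 2)"
  define k where "k = n - 2"
  have k: "n = Suc (Suc k)" and k0: "real n - 2 > 0" "k > 0" using n by (simp_all add: k_def)
  define h where "h = bn_f n lam (v a) / v a"
  \<comment> \<open>A primitive of \<open>(x ^ n - a ^ n) / x ^ (n - 1)\<close>, the factor coming
    from the flux bound.\<close>
  define G where "G x = x\<^sup>2 / 2 + a ^ n / ((real n - 2) * x ^ (n - 2))" for x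
  define g where "g x = (v x / v a) powr (- K) - K / real n * h * G x" for x
  have p: "(real n + 2) / (real n - 2) = 1 + K"
    using n by (simp add: field_simps K_def)
  have K0: "K > 0" using n by (simp add: K_def)
  have "g a \<le> g r"
  proof (rule nonneg_deriv_imp_le[where f = g])
    fix x assume x: "a < x" "x < r"
    then have xI: "x \<in> {a<..<b}" using r by auto
    note S = solD[OF xI]
    have DG: "(G has_real_derivative x - a ^ n / x ^ (n - 1)) (at x)"
    proof -
      have D: "((\<lambda>x. x ^ k) has_real_derivative real k * (x ^ k / x)) (at x)"
        using S(1) k0(2) by (auto intro!: derivative_eq_intros simp: power_diff)
      have "((\<lambda>x. inverse (x ^ k)) has_real_derivative
          - (real k * (x ^ k / x) * inverse ((x ^ k) ^ Suc (Suc 0)))) (at x)"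
        using D S(1) by (intro DERIV_inverse_fun) auto
      then have DI: "((\<lambda>x. inverse (x ^ k)) has_real_derivative
          - (real k * (x ^ k / x) / (x ^ k * x ^ k))) (at x)"
        by (simp add: divide_inverse)
      have G: "G = (\<lambda>x. 1 / 2 * x\<^sup>2 + a ^ n / real k * inverse (x ^ k))"
        by (simp add: G_def[abs_def] k field_simps)
      have "(G has_real_derivative 1 / 2 * (2 * x)
          + a ^ n / real k * - (real k * (x ^ k / x) / (x ^ k * x ^ k))) (at x)"
        unfolding G by (rule DI derivative_eq_intros refl | simp)+
      also have "1 / 2 * (2 * x) + a ^ n / real k * - (real k * (x ^ k / x) / (x ^ k * x ^ k))
          = x - a ^ n / x ^ (n - 1)"
        using S(1) k0(2) by (simp add: k)
      finally show ?thesis .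
    qed
    have Dv: "((\<lambda>x. (v x / v a) powr (- K)) has_real_derivative
        - K * (v x / v a) powr (- K - 1) * (v' x / v a)) (at x)"
      using S va by (auto intro!: derivative_eq_intros)
    have D: "(g has_real_derivative - K * (v x / v a) powr (- K - 1) * (v' x / v a)
        - K / real n * h * (x - a ^ n / x ^ (n - 1))) (at x)"
      unfolding g_def by (rule DG Dv derivative_eq_intros refl)+ simp
    have "h * v x powr (1 + K) \<le> bn_f n lam (v x) * v a powr K"
      using ratio_le[of x] x r va by (simp add: p h_def K_def)
    then have "h \<le> bn_f n lam (v x) * v a powr K / v x powr (1 + K)"
      using S(2) by (simp add: pos_le_divide_eq)
    also have "\<dots> = (v x / v a) powr (- K - 1) * bn_f n lam (v x) / v a"
      using S(2) va by (simp add: powr_divide powr_diff powr_minus powr_add field_simps)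
    finally have h: "h \<le> (v x / v a) powr (- K - 1) * bn_f n lam (v x) / v a" .
    have xa: "x - a ^ n / x ^ (n - 1) = (x ^ n - a ^ n) / x ^ (n - 1)"
      using S(1) by (simp add: k field_simps)
    have xa0: "(x ^ n - a ^ n) / x ^ (n - 1) \<ge> 0"
      using x a S(1) by (simp add: power_mono)
    have "h * ((x ^ n - a ^ n) / x ^ (n - 1))
        \<le> (v x / v a) powr (- K - 1) * bn_f n lam (v x) / v a * ((x ^ n - a ^ n) / x ^ (n - 1))"
      using h xa0 by (rule mult_right_mono)
    also have "\<dots> = (v x / v a) powr (- K - 1) / v a * (bn_f n lam (v x) * (x ^ n - a ^ n) / x ^ (n - 1))"
      by simp
    also have "\<dots> \<le> (v x / v a) powr (- K - 1) / v a * (- real n * v' x)"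
    proof (rule mult_left_mono)
      have "bn_f n lam (v x) * (x ^ n - a ^ n) \<le> - real n * v' x * x ^ (n - 1)"
        using flux_bound[OF xI] n by (simp add: field_simps)
      then show "bn_f n lam (v x) * (x ^ n - a ^ n) / x ^ (n - 1) \<le> - real n * v' x"
        using S(1) by (simp add: pos_divide_le_eq)
    qed (use va in auto)
    finally have "K / real n * (h * (x - a ^ n / x ^ (n - 1)))
        \<le> K / real n * ((v x / v a) powr (- K - 1) / v a * (- real n * v' x))"
      unfolding xa using K0 by (intro mult_left_mono) auto
    then have "- K * (v x / v a) powr (- K - 1) * (v' x / v a)
        - K / real n * h * (x - a ^ n / x ^ (n - 1)) \<ge> 0"
      using n by simp
    with D show "\<exists>y. (g has_real_derivative y) (at x) \<and> 0 \<le> y" by blast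
  next
    have "continuous_on {a..r} G"
    \<comment> \<open>For \<open>a = 0\<close> the second term of \<open>G\<close> is zero
      everywhere, even at \<open>x = 0\<close>, where division by zero returns
      \<open>0\<close>.\<close>
    proof (cases "a = 0")
      case True
      then show ?thesis unfolding G_def using n by (auto intro!: continuous_intros simp: k)
    next
      case False
      then show ?thesis unfolding G_def using n a by (auto intro!: continuous_intros)
    qed
    moreover have "v x > 0" if "x \<in> {a..r}" for x
      using that r solD(2)[of x] va by (cases "x = a") auto
    ultimately show "continuous_on {a..r} g"
      unfolding g_def using r cont_sub va by (fastforce intro!: continuous_intros)
  qed (use r in auto)
  moreover have "G a = a\<^sup>2 / 2 + a\<^sup>2 / (real n - 2)"
    using k0 by (cases "a = 0") (auto simp: G_def k power2_eq_square)
  ultimately have "1 + K / real n * h * (G r - a\<^sup>2 / 2 - a\<^sup>2 / (real n - 2)) \<le> (v r / v a) powr (- K)"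
    using va by (simp add: g_def algebra_simps)
  then show ?thesis
    by (simp add: G_def K_def h_def mult.commute)
qed

text \<open>At the left end the gradient terms of the Pohozaev function vanish, and afterwards it only
  increases; its sign is that of the derivative of \<open>- v' / (r v powr (n / (n - 2)))\<close>.\<close>

lemma pohozaev_nonneg:
  assumes r: "r \<in> {a<..<b}" and va: "v a > 0"
  shows "pohozaev n lam v v' r \<ge> 0"
proof -
  have "pohozaev n lam v v' a \<le> pohozaev n lam v v' r"
  proof (rule nonneg_deriv_imp_le[where f = "pohozaev n lam v v'"])
    fix x assume "a < x" "x < r"
    then have xI: "x \<in> {a<..<b}" using r by auto
    have "- (2 * lam / real n) * x ^ n * v x * v' x \<ge> 0"
      using solD(1,2)[OF xI] deriv_nonpos[OF xI] lam
      by (simp add: mult_nonneg_nonpos divide_nonpos_nonneg)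
    then show "\<exists>y. (pohozaev n lam v v' has_real_derivative y) (at x) \<and> 0 \<le> y"
      using pohozaev_deriv[OF n sol xI] by blast
  next
    have "v x \<ge> 0" if "x \<in> {a..r}" for x
      using that r solD(2)[of x] va by (cases "x = a") auto
    then show "continuous_on {a..r} (pohozaev n lam v v')"
      unfolding pohozaev_def[abs_def] using r cont_sub n
      by (auto intro!: continuous_intros)
  qed (use r in auto)
  moreover have "pohozaev n lam v v' a \<ge> 0"
  proof -
    \<comment> \<open>Splitting off the flux lets \<open>flux0\<close> settle \<open>a = 0\<close>
      and \<open>v' a = 0\<close> at once.\<close>
    have "a ^ n * (v' a)\<^sup>2 = (a ^ (n - 1) * v' a) * (a * v' a)"
      using n by (cases n) (auto simp: power2_eq_square)
    then have "a ^ n * (v' a)\<^sup>2 = 0" using flux0 by simp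
    moreover have "(real n - 2) / 2 * a ^ (n - 1) * v a * v' a
        = (a ^ (n - 1) * v' a) * ((real n - 2) / 2 * v a)" by simp
    then have "(real n - 2) / 2 * a ^ (n - 1) * v a * v' a = 0" using flux0 by auto
    moreover have "(real n - 2) / (2 * real n) * a ^ n * v a * bn_f n lam (v a) \<ge> 0"
      using n va a lam bn_f_nonneg[of lam "v a" n] by simp
    ultimately show ?thesis unfolding pohozaev_def by linarith
  qed
  ultimately show ?thesis by simp
qed

section \<open>Convexity in the squared radius\<close>

definition slope :: "real \<Rightarrow> real" where
  "slope r = - v' r / (r * v r powr (real n / (real n - 2)))"

lemma slope_mono:
  assumes x: "a < x" "x \<le> y" "y < b" and va: "v a > 0"
  shows "slope x \<le> slope y"
proof (rule nonneg_deriv_imp_le[where f = slope])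
  fix r assume "x < r" "r < y"
  then have r: "r \<in> {a<..<b}" using x by auto
  note S = solD[OF r]
  define q where "q = real n / (real n - 2)"
  define k where "k = n - 2"
  have k: "n = Suc (Suc k)" and k0: "real k > 0" using n by (simp_all add: k_def)
  define f where "f = bn_f n lam (v r)"
  have Dq: "((\<lambda>r. v r powr q) has_real_derivative q * (v r powr q / v r) * v' r) (at r)"
    using S by (auto intro!: derivative_eq_intros simp: powr_diff)
  have ne: "r * v r powr q \<noteq> 0" using S by simp
  define L where "L = (- (- ((real n - 1) / r * v' r + f)) * (r * v r powr q)
      - - v' r * (1 * v r powr q + q * (v r powr q / v r) * v' r * r)) / ((r * v r powr q) * (r * v r powr q))"
  have D: "(slope has_real_derivative L) (at r)"
    unfolding slope_def[abs_def] q_def[symmetric] L_def f_def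
    by (rule S(4) Dq derivative_eq_intros refl ne)+
  \<comment> \<open>With \<open>v''\<close> eliminated by the equation, the numerator of the
    quotient rule, times \<open>v r\<close>, is a positive multiple of the Pohozaev
    function.\<close>
  have "pohozaev n lam v v' r * (2 * real n / (real n - 2)) * v r powr q / r ^ (n - 1)
      = L * ((r * v r powr q) * (r * v r powr q)) * v r"
    unfolding L_def pohozaev_def f_def[symmetric] q_def using S(1,2) k0
    by (simp add: k divide_simps) (simp add: algebra_simps power2_eq_square)
  moreover have "pohozaev n lam v v' r * (2 * real n / (real n - 2)) * v r powr q / r ^ (n - 1) \<ge> 0"
    using pohozaev_nonneg[OF r va] S n by simp
  ultimately have "0 \<le> L * ((r * v r powr q) * (r * v r powr q) * v r)"
    by (simp add: mult.assoc)
  moreover have "(r * v r powr q) * (r * v r powr q) * v r > 0"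
    using S by simp
  ultimately have "L \<ge> 0"
    by (simp only: zero_le_mult_iff) linarith
  with D show "\<exists>l. (slope has_real_derivative l) (at r) \<and> 0 \<le> l" by blast
next
  have "continuous_on {x..y} v" "continuous_on {x..y} v'"
    using x cont by (auto intro: continuous_on_subset)
  moreover have "v r > 0 \<and> r > 0" if "r \<in> {x..y}" for r
    using that x solD(1,2)[of r] by auto
  ultimately show "continuous_on {x..y} slope"
    unfolding slope_def[abs_def] by (fastforce intro!: continuous_intros)
qed (use x in auto)

text \<open>In the variable \<open>r\<^sup>2\<close>, the function \<open>w = (v / v a) powr (-2 / (n - 2))\<close> has derivative a
  multiple of \<open>slope\<close>, so it is convex, and the statement is monotonicity of a secant slope.\<close>

lemma quotient_mono:
  assumes a0: "a > 0" and x: "a < x" "x \<le> y" "y < b" and va: "v a > 0"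
  shows "((v x / v a) powr (- 2 / (real n - 2)) - 1) / x\<^sup>2
    \<le> ((v y / v a) powr (- 2 / (real n - 2)) - 1) / y\<^sup>2"
proof -
  \<comment> \<open>This \<open>m\<close> is the exponent in \<open>w\<close>, the reciprocal of
    \<open>(n - 2) / 2\<close>.\<close>
  define m where "m = 2 / (real n - 2)"
  have m0: "m > 0" using n by (simp add: m_def)
  define w where "w r = (v r / v a) powr (- m)" for r
  define K where "K = m * v a powr m"
  have K0: "K > 0" using m0 va by (simp add: K_def)
  have q: "real n / (real n - 2) = 1 + m" using n by (simp add: m_def field_simps)
  have Dw: "(w has_real_derivative K * r * slope r) (at r)" if r: "r \<in> {a<..<b}" for r
  proof -
    note S = solD[OF r]
    have "(w has_real_derivative - m * (v r / v a) powr (- m - 1) * (v' r / v a)) (at r)"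
      unfolding w_def[abs_def] using S va by (auto intro!: derivative_eq_intros)
    moreover have "(v r / v a) powr (- m - 1) = v a powr m * v a / (v r powr m * v r)"
      using S va by (simp add: powr_divide powr_diff powr_minus field_simps)
    then have "- m * (v r / v a) powr (- m - 1) * (v' r / v a) = K * r * slope r"
      using S va by (simp add: K_def slope_def q powr_add field_simps)
    ultimately show ?thesis by simp
  qed
  have cw: "continuous_on {a..r} w" if "r < b" for r
  proof -
    have "v x > 0" if "x \<in> {a..r}" for x
      using that \<open>r < b\<close> solD(2)[of x] va by (cases "x = a") auto
    then show ?thesis
      unfolding w_def[abs_def] using cont_sub[OF that] va
      by (fastforce intro!: continuous_intros)
  qed
  \<comment> \<open>The tangent inequality for \<open>w\<close> as a convex function of
    \<open>r\<^sup>2\<close>, with the length \<open>r\<^sup>2 - a\<^sup>2\<close> enlarged to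
    \<open>r\<^sup>2\<close>. It is exactly the sign of the derivative of
    \<open>(w r - 1) / r\<^sup>2\<close>.\<close>
  have w1: "w r - 1 \<le> K * slope r * r\<^sup>2 / 2" if r: "r \<in> {a<..<b}" for r
  proof -
    define g where "g z = w z - K * slope r / 2 * z\<^sup>2" for z
    have "g r \<le> g a"
    proof (rule nonpos_deriv_imp_ge[where f = g])
      fix z assume z: "a < z" "z < r"
      then have zI: "z \<in> {a<..<b}" using r by auto
      have "(g has_real_derivative K * z * slope z - K * slope r / 2 * (2 * z)) (at z)"
        unfolding g_def[abs_def] by (auto intro!: derivative_eq_intros Dw[OF zI])
      moreover have "K * z * slope z \<le> K * z * slope r"
        using slope_mono[of z r] z r va K0 a by (intro mult_left_mono) auto
      ultimately show "\<exists>d. (g has_real_derivative d) (at z) \<and> d \<le> 0"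
        by (intro exI conjI) (auto simp: algebra_simps)
    next
      show "continuous_on {a..r} g"
        unfolding g_def[abs_def] using cw[of r] r by (auto intro!: continuous_intros)
    qed (use r in auto)
    moreover have "w a = 1" using va by (simp add: w_def)
    moreover have "slope r \<ge> 0"
      using solD[OF r] deriv_nonpos[OF r] by (simp add: slope_def divide_nonpos_pos)
    then have "K * slope r / 2 * a\<^sup>2 \<ge> 0" using K0 by simp
    ultimately show ?thesis by (simp add: g_def)
  qed
  have "(w x - 1) / x\<^sup>2 \<le> (w y - 1) / y\<^sup>2"
  proof (rule nonneg_deriv_imp_le[where f = "\<lambda>r. (w r - 1) / r\<^sup>2"])
    fix r assume "x < r" "r < y"
    then have r: "r \<in> {a<..<b}" using x by auto
    have r0: "r > 0" using solD(1)[OF r] .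
    have "((\<lambda>r. (w r - 1) / r\<^sup>2) has_real_derivative
        2 / r ^ 3 * (K * slope r * r\<^sup>2 / 2 - (w r - 1))) (at r)"
      using r0 by (auto intro!: derivative_eq_intros Dw[OF r]
          simp: divide_simps power2_eq_square power3_eq_cube) (auto simp: algebra_simps)
    moreover have "2 / r ^ 3 * (K * slope r * r\<^sup>2 / 2 - (w r - 1)) \<ge> 0"
      using w1[OF r] r0 by simp
    ultimately show "\<exists>d. ((\<lambda>r. (w r - 1) / r\<^sup>2) has_real_derivative d) (at r) \<and> 0 \<le> d"
      by blast
  next
    have "continuous_on {x..y} w"
      using cw[of y] x by (auto intro: continuous_on_subset)
    then show "continuous_on {x..y} (\<lambda>r. (w r - 1) / r\<^sup>2)"
      using x a0 by (auto intro!: continuous_intros)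
  qed (use x in auto)
  then show ?thesis by (simp add: w_def m_def)
qed

end

section \<open>The Pohozaev identity\<close>

text \<open>The added term cancels the \<open>v'\<close> in \<open>pohozaev_deriv\<close>, so the
  sign of the derivative is known even where \<open>v\<close> is not monotone.\<close>

lemma pohozaev_augmented_deriv:
  assumes n: "n \<ge> 3" and sol: "radial_pos_solution n lam I v v'" and r: "r \<in> I"
  shows "((\<lambda>r. pohozaev n lam v v' r + lam / real n * r ^ n * (v r)\<^sup>2)
    has_real_derivative lam * r ^ (n - 1) * (v r)\<^sup>2) (at r)"
proof -
  note * = sol[unfolded radial_pos_solution_def, rule_format, OF r]
  have dv: "(v has_real_derivative v' r) (at r)" using * by auto
  have D: "((\<lambda>r. r ^ n) has_real_derivative real n * r ^ (n - 1)) (at r)"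
    using DERIV_pow[of n r] by simp
  show ?thesis
    apply (rule pohozaev_deriv[OF n sol r] D dv derivative_eq_intros refl)+
    using n by (simp add: field_simps power2_eq_square)
qed

lemma continuous_on_pohozaev:
  assumes "n \<ge> 3" "continuous_on S v" "continuous_on S v'" "\<And>r. r \<in> S \<Longrightarrow> v r \<ge> 0"
  shows "continuous_on S (pohozaev n lam v v')"
  unfolding pohozaev_def[abs_def] using assms by (auto intro!: continuous_intros)

text \<open>The bound \<open>n (n - 2) / 2\<close> on
  \<open>v powr (4 / (n - 2)) * r\<^sup>2\<close>, raised to the power
  \<open>(n - 2) / 2\<close>.\<close>

definition bubble_const :: "nat \<Rightarrow> real" where
  "bubble_const n = (real n * (real n - 2) / 2) powr ((real n - 2) / 2)"

context radial_decreasing_solution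
begin

text \<open>In \<open>decay\<close> with \<open>a = 0\<close>, dropping \<open>1\<close> and
  \<open>lam\<close> leaves a factor \<open>v a powr K\<close> on both sides. Cancelling it makes
  the bound independent of the height at the centre and of \<open>lam\<close>.\<close>

lemma bubble_bound:
  assumes a0: "a = 0" and va: "v a > 0" and r: "r \<in> {a<..<b}"
  shows "r ^ (n - 2) * (v r)\<^sup>2 \<le> bubble_const n"
proof -
  define K where "K = 4 / (real n - 2)"
  have K0: "K > 0" using n by (simp add: K_def)
  note S = solD[OF r]
  have N: "real n * (real n - 2) > 0" using n by simp
  have h: "bn_f n lam (v a) / v a = lam + v a powr K"
    using va n by (simp add: bn_f_altdef K_def)
  have "v a powr K * (4 / (real n * (real n - 2)) * (r\<^sup>2 / 2))
      \<le> (lam + v a powr K) * (4 / (real n * (real n - 2)) * (r\<^sup>2 / 2))"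
    using lam N by (intro mult_right_mono) auto
  also have "\<dots> \<le> (v r / v a) powr (- K)"
  proof -
    have z: "a ^ n = 0" using a0 n by simp
    have "1 + 4 / (real n * (real n - 2)) * (lam + v a powr K) * (r\<^sup>2 / 2) \<le> (v r / v a) powr (- K)"
      using decay[OF r va] unfolding h K_def[symmetric] z by (simp add: a0)
    moreover have "(lam + v a powr K) * (4 / (real n * (real n - 2)) * (r\<^sup>2 / 2))
        = 4 / (real n * (real n - 2)) * (lam + v a powr K) * (r\<^sup>2 / 2)"
      by (simp only: mult_ac)
    ultimately show ?thesis by linarith
  qed
  also have "\<dots> = v a powr K * (1 / v r powr K)"
    using S va by (simp add: powr_divide powr_minus field_simps)
  finally have "4 / (real n * (real n - 2)) * (r\<^sup>2 / 2) \<le> 1 / v r powr K"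
    by (rule mult_left_le_imp_le) (use va in simp)
  then have "v r powr K * r\<^sup>2 \<le> real n * (real n - 2) / 2"
    using S N by (simp add: field_simps)
  then have "(v r powr K * r\<^sup>2) powr ((real n - 2) / 2) \<le> bubble_const n"
    unfolding bubble_const_def using n by (intro powr_mono2) auto
  also have "(v r powr K * r\<^sup>2) powr ((real n - 2) / 2) = v r powr 2 * r powr (real n - 2)"
  proof -
    have "K * ((real n - 2) / 2) = 2" "2 * ((real n - 2) / 2) = real n - 2"
      using n by (auto simp: K_def field_simps)
    moreover have "r\<^sup>2 = r powr 2" using S(1) by simp
    ultimately show ?thesis using S(1,2) by (simp only: powr_mult powr_powr)
  qed
  also have "\<dots> = r ^ (n - 2) * (v r)\<^sup>2"
    using S n powr_realpow[of r "n - 2"] by (simp add: of_nat_diff)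
  finally show ?thesis .
qed

text \<open>By \<open>bubble_bound\<close> the augmented Pohozaev function has derivative at most
  \<open>lam * bubble_const n * r\<close>. It starts at zero, and the added term vanishes at
  \<open>b\<close> because \<open>v b = 0\<close>.\<close>

lemma pohozaev_node:
  assumes a0: "a = 0" and va: "v a > 0" and vb: "v b = 0" and ab: "a < b"
    and cont': "continuous_on {a..b} v" "continuous_on {a..b} v'"
  shows "pohozaev n lam v v' b \<le> lam * bubble_const n / 2 * b\<^sup>2"
proof -
  define g where "g r = pohozaev n lam v v' r + lam / real n * r ^ n * (v r)\<^sup>2
      - lam * bubble_const n / 2 * r\<^sup>2" for r
  have "g b \<le> g a"
  proof (rule nonpos_deriv_imp_ge[where f = g])
    fix x assume "a < x" "x < b"
    then have x: "x \<in> {a<..<b}" by simp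
    have "(g has_real_derivative lam * x ^ (n - 1) * (v x)\<^sup>2 - lam * bubble_const n / 2 * (2 * x)) (at x)"
      unfolding g_def[abs_def]
      by (rule pohozaev_augmented_deriv[OF n sol x] derivative_eq_intros refl)+ simp
    moreover have "x ^ (n - 1) = x ^ (n - 2) * x"
      using n by (subst power_Suc2[symmetric]) (simp add: Suc_diff_Suc numeral_2_eq_2)
    then have "lam * x ^ (n - 1) * (v x)\<^sup>2 = lam * x * (x ^ (n - 2) * (v x)\<^sup>2)"
      by (simp only: mult_ac)
    then have "lam * x ^ (n - 1) * (v x)\<^sup>2 \<le> lam * x * bubble_const n"
      using bubble_bound[OF a0 va x] lam solD(1)[OF x]
      by (simp only:) (intro mult_left_mono, auto)
    ultimately show "\<exists>y. (g has_real_derivative y) (at x) \<and> y \<le> 0"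
      by (intro exI conjI) (auto simp: algebra_simps)
  next
    have "v x \<ge> 0" if "x \<in> {a..b}" for x
      using that solD(2)[of x] va vb by (cases "x = a \<or> x = b") auto
    then show "continuous_on {a..b} g"
      unfolding g_def[abs_def] using cont' n
      by (auto intro!: continuous_intros continuous_on_pohozaev)
  qed (use ab in auto)
  moreover have z: "a ^ n = 0" "a ^ (n - 1) = 0" using a0 n by auto
  have "g a = 0" unfolding g_def pohozaev_def z using a0 by simp
  ultimately have "g b \<le> 0" by simp
  then show ?thesis by (simp add: g_def vb)
qed

end

text \<open>Replacing \<open>v\<close> by its maximum in the derivative of the augmented function
  shows that the growth is at most \<open>lam / n * (v b)\<^sup>2 * (b ^ n - a ^ n)\<close>, which
  the added term at \<open>b\<close> absorbs.\<close>

lemma pohozaev_node_to_max: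
  assumes n: "n \<ge> 3" and lam: "lam \<ge> 0" and ab: "0 < a" "a < b"
    and sol: "radial_pos_solution n lam {a<..<b} v v'"
    and cont: "continuous_on {a..b} v" "continuous_on {a..b} v'"
    and va: "v a = 0" and max: "\<And>r. r \<in> {a..b} \<Longrightarrow> v r \<le> v b"
  shows "pohozaev n lam v v' b \<le> pohozaev n lam v v' a"
proof -
  have nonneg: "v x \<ge> 0" if "x \<in> {a..<b}" for x
    using that sol va by (cases "x = a") (auto simp: radial_pos_solution_def less_imp_le)
  then have nonneg: "v x \<ge> 0" if "x \<in> {a..b}" for x
    using that max[of a] va ab by (cases "x = b") auto
  define g where "g r = pohozaev n lam v v' r + lam / real n * r ^ n * (v r)\<^sup>2
      - lam / real n * (v b)\<^sup>2 * r ^ n" for r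
  have "g b \<le> g a"
  proof (rule nonpos_deriv_imp_ge[where f = g])
    fix x assume x: "a < x" "x < b"
    then have xI: "x \<in> {a<..<b}" by simp
    have D: "((\<lambda>r. r ^ n) has_real_derivative real n * x ^ (n - 1)) (at x)"
      using DERIV_pow[of n x] by simp
    have "(g has_real_derivative lam * x ^ (n - 1) * (v x)\<^sup>2 - lam * x ^ (n - 1) * (v b)\<^sup>2) (at x)"
      unfolding g_def[abs_def]
      apply (rule pohozaev_augmented_deriv[OF n sol xI] D derivative_eq_intros refl)+
      using n by simp
    moreover have "lam * x ^ (n - 1) * (v x)\<^sup>2 \<le> lam * x ^ (n - 1) * (v b)\<^sup>2"
      using max[of x] nonneg[of x] x ab lam by (intro mult_left_mono power_mono) auto
    ultimately show "\<exists>y. (g has_real_derivative y) (at x) \<and> y \<le> 0"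
      by (intro exI conjI) auto
  next
    show "continuous_on {a..b} g"
      unfolding g_def[abs_def] using cont n nonneg
      by (auto intro!: continuous_intros continuous_on_pohozaev)
  qed (use ab in auto)
  moreover have "lam / real n * (v b)\<^sup>2 * a ^ n \<ge> 0" using lam ab by simp
  ultimately show ?thesis by (simp add: g_def va)
qed

text \<open>Where \<open>v'\<close> vanishes only the last Pohozaev term remains. Without its
  \<open>lam\<close> part it is a multiple of \<open>s ^ n * M powr (2 * n / (n - 2))\<close>; the
  power \<open>2 / n\<close> turns this into the scale-invariant quantity on the left.\<close>

lemma pohozaev_critical_point:
  assumes n: "n \<ge> 3" and lam: "lam \<ge> 0" and s: "s > 0" and v: "v s > 0" and v': "v' s = 0"
    and le: "pohozaev n lam v v' s \<le> lam * C"
  shows "v s powr (4 / (real n - 2)) * s\<^sup>2 \<le> (2 * real n / (real n - 2) * C * lam) powr (2 / real n)"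
proof -
  define K where "K = 4 / (real n - 2)"
  define M where "M = v s"
  have M: "M > 0" using v by (simp add: M_def)
  have "(real n - 2) / (2 * real n) * (s ^ n * M\<^sup>2 * M powr K)
      \<le> (real n - 2) / (2 * real n) * (s ^ n * M\<^sup>2 * (lam + M powr K))"
    using n lam s by (intro mult_left_mono) auto
  also have "\<dots> = pohozaev n lam v v' s"
    using n M by (simp add: pohozaev_def v' M_def[symmetric] bn_f_altdef K_def power2_eq_square)
  finally have "(real n - 2) / (2 * real n) * (s ^ n * M\<^sup>2 * M powr K) \<le> lam * C"
    using le by simp
  then have "s ^ n * M\<^sup>2 * M powr K \<le> lam * C / ((real n - 2) / (2 * real n))"
    using n by (subst pos_le_divide_eq) (auto simp: mult.commute)
  also have "\<dots> = 2 * real n / (real n - 2) * C * lam" by simp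
  finally have "s ^ n * M\<^sup>2 * M powr K \<le> 2 * real n / (real n - 2) * C * lam" .
  then have "(s ^ n * M\<^sup>2 * M powr K) powr (2 / real n) \<le> (2 * real n / (real n - 2) * C * lam) powr (2 / real n)"
    using s n by (intro powr_mono2) auto
  also have "s ^ n * M\<^sup>2 * M powr K = s powr real n * M powr (2 + K)"
    using s M by (simp add: powr_realpow powr_add)
  also have "2 + K = 2 * real n / (real n - 2)"
    using n by (simp add: K_def field_simps)
  also have "(s powr real n * M powr (2 * real n / (real n - 2))) powr (2 / real n) = M powr K * s\<^sup>2"
    using s M n by (simp add: powr_mult powr_powr K_def)
  finally show ?thesis by (simp add: M_def K_def)
qed

section \<open>The bubble bound beyond the extremum\<close>

text \<open>The left side is the bracket of \<open>decay\<close> at \<open>R = a / \<sigma>\<close>,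
  up to the factor \<open>R\<^sup>2 / 2\<close>. The two sides differ by \<open>2 * \<sigma> / k *
  (k - (k + 1) * \<sigma> + \<sigma> ^ (k + 1))\<close> with \<open>k = n - 2\<close>, and
  Bernoulli's inequality at exponent \<open>k + 1\<close> gives the sign.\<close>

lemma bernoulli_deficit:
  fixes \<sigma> :: real
  assumes n: "n \<ge> 3" and \<sigma>: "0 \<le> \<sigma>"
  shows "1 + 2 * \<sigma> ^ n / (real n - 2) - \<sigma>\<^sup>2 - 2 * \<sigma>\<^sup>2 / (real n - 2) \<ge> (1 - \<sigma>)\<^sup>2"
proof -
  define k where "k = n - 2"
  have k: "n = Suc (Suc k)" and k0: "real k > 0" using n by (simp_all add: k_def)
  have "1 + real (n - 1) * (\<sigma> - 1) \<le> (1 + (\<sigma> - 1)) ^ (n - 1)"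
    using \<sigma> by (intro Bernoulli_inequality) auto
  then have "0 \<le> 2 * \<sigma> / real k * (real k - (real k + 1) * \<sigma> + \<sigma> * \<sigma> ^ k)"
    using \<sigma> k0 by (intro mult_nonneg_nonneg) (auto simp: k algebra_simps)
  also have "\<dots> = 1 + 2 * \<sigma> ^ n / (real n - 2) - \<sigma>\<^sup>2 - 2 * \<sigma>\<^sup>2 / (real n - 2) - (1 - \<sigma>)\<^sup>2"
    using k0 by (simp add: k field_simps power2_eq_square)
  finally show ?thesis by simp
qed

text \<open>With \<open>R = a / (1 - t)\<close> and \<open>z = A * R\<^sup>2\<close>,
  \<open>decay\<close> yields \<open>(w R)\<^sup>2 \<ge> 1 + 2 * t\<^sup>2 * z\<close>, while
  \<open>w R \<ge> 1 + t ^ 4 * z\<close> is wanted. Comparing squares requires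
  \<open>z * t ^ 6 \<le> 2 * (1 - t\<^sup>2)\<close>, which is what \<open>small\<close>
  encodes.\<close>

lemma (in radial_decreasing_solution) bubble_upper_bound:
  fixes t :: real
  defines "h \<equiv> bn_f n lam (v a) / v a"
  assumes a0: "a > 0" and va: "v a > 0" and t: "0 < t" "t < 1"
    and small: "h * a\<^sup>2 \<le> real n * (real n - 2) * (2 * (1 - t\<^sup>2) * (1 - t)\<^sup>2 / t ^ 6)"
    and r: "a / (1 - t) < r" "r < b"
  shows "v r \<le> v a * (1 + h / (real n * (real n - 2)) * t ^ 4 * r\<^sup>2) powr (- (real n - 2) / 2)"
proof -
  define \<sigma> where "\<sigma> = 1 - t"
  define R where "R = a / \<sigma>"
  define A where "A = h / (real n * (real n - 2))"
  have \<sigma>: "0 < \<sigma>" "\<sigma> < 1" using t by (auto simp: \<sigma>_def)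
  have N: "real n * (real n - 2) > 0" using n by simp
  have A0: "A \<ge> 0" using N va lam bn_f_nonneg[of lam "v a" n] by (simp add: A_def h_def)
  have aR: "a = \<sigma> * R" using \<sigma> by (simp add: R_def)
  have R: "a < R" "R < r" "R > 0"
    using r \<sigma> a0 by (auto simp: R_def \<sigma>_def field_simps)
  then have RI: "R \<in> {a<..<b}" and rI: "r \<in> {a<..<b}" using r by auto
  define w where "w x = (v x / v a) powr (- 2 / (real n - 2))" for x
  have wpos: "w x > 0" if "x \<in> {a<..<b}" for x using solD(2)[OF that] va by (simp add: w_def)
  have w2: "(w R)\<^sup>2 = (v R / v a) powr (- (4 / (real n - 2)))"
    using solD(2)[OF RI] va by (simp add: w_def power2_eq_square flip: powr_add)
  have br: "R\<^sup>2 / 2 + a ^ n / ((real n - 2) * R ^ (n - 2)) - a\<^sup>2 / 2 - a\<^sup>2 / (real n - 2)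
      = R\<^sup>2 / 2 * (1 + 2 * \<sigma> ^ n / (real n - 2) - \<sigma>\<^sup>2 - 2 * \<sigma>\<^sup>2 / (real n - 2))"
  proof -
    have "2 \<le> n" using n by simp
    then have "R ^ n = R\<^sup>2 * R ^ (n - 2)" using power_add[of R 2 "n - 2"] by (simp only: le_add_diff_inverse)
    then have e: "(\<sigma> * R) ^ n / ((real n - 2) * R ^ (n - 2)) = \<sigma> ^ n * R\<^sup>2 / (real n - 2)"
      using R(3) by (simp add: power_mult_distrib)
    have alg: "x / 2 + p * x / c - q * x / 2 - q * x / c = x / 2 * (1 + 2 * p / c - q - 2 * q / c)"
      if "c \<noteq> 0" for x p q c :: real
      using that by (simp add: field_simps)
    show ?thesis
      unfolding aR e unfolding power_mult_distrib[of _ _ 2] using n by (intro alg) simp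
  qed
  have A4: "4 * A = 4 / (real n * (real n - 2)) * h" by (simp add: A_def)
  have "(w R)\<^sup>2 \<ge> 1 + 4 * A * (R\<^sup>2 / 2 * (1 + 2 * \<sigma> ^ n / (real n - 2) - \<sigma>\<^sup>2 - 2 * \<sigma>\<^sup>2 / (real n - 2)))"
    unfolding w2 A4 br[symmetric] h_def by (rule decay[OF RI va])
  moreover have "4 * A * (R\<^sup>2 / 2 * (1 + 2 * \<sigma> ^ n / (real n - 2) - \<sigma>\<^sup>2 - 2 * \<sigma>\<^sup>2 / (real n - 2)))
      \<ge> 4 * A * (R\<^sup>2 / 2 * t\<^sup>2)"
    using bernoulli_deficit[OF n, of \<sigma>] \<sigma> A0 by (intro mult_left_mono) (auto simp: \<sigma>_def)
  ultimately have "(w R)\<^sup>2 \<ge> 1 + 4 * A * (R\<^sup>2 / 2 * t\<^sup>2)" by linarith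
  then have wR: "(w R)\<^sup>2 \<ge> 1 + 2 * t\<^sup>2 * (A * R\<^sup>2)" by (simp add: mult_ac)
  define z where "z = A * R\<^sup>2"
  have z0: "z \<ge> 0" using A0 by (simp add: z_def)
  have "h * a\<^sup>2 = real n * (real n - 2) * (\<sigma>\<^sup>2 * z)"
    using n by (simp add: A_def z_def aR power_mult_distrib)
  with small have "\<sigma>\<^sup>2 * z \<le> 2 * (1 - t\<^sup>2) * (1 - t)\<^sup>2 / t ^ 6"
    using mult_le_cancel_left_pos[OF N] by metis
  also have "\<dots> = \<sigma>\<^sup>2 * (2 * (1 - t\<^sup>2) / t ^ 6)" by (simp add: \<sigma>_def)
  finally have "z \<le> 2 * (1 - t\<^sup>2) / t ^ 6"
    using mult_le_cancel_left_pos[of "\<sigma>\<^sup>2"] \<sigma> by (metis zero_less_power)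
  then have zt: "z * t ^ 6 \<le> 2 * (1 - t\<^sup>2)" using t by (simp add: pos_le_divide_eq)
  have "(1 + t ^ 4 * z)\<^sup>2 = 1 + 2 * t ^ 4 * z + t\<^sup>2 * z * (z * t ^ 6)"
    by (simp add: algebra_simps eval_nat_numeral)
  also have "\<dots> \<le> 1 + 2 * t ^ 4 * z + t\<^sup>2 * z * (2 * (1 - t\<^sup>2))"
    using zt z0 by (intro add_left_mono mult_left_mono) auto
  also have "\<dots> = 1 + 2 * t\<^sup>2 * z" by (simp add: algebra_simps eval_nat_numeral)
  also have "\<dots> \<le> (w R)\<^sup>2" using wR by (simp add: z_def)
  finally have "1 + t ^ 4 * z \<le> w R"
    by (rule power2_le_imp_le) (use wpos[OF RI] in simp)
  then have "t ^ 4 * A \<le> (w R - 1) / R\<^sup>2"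
    using R by (simp add: z_def pos_le_divide_eq mult_ac)
  \<comment> \<open>Convexity carries the estimate from the single radius \<open>R\<close> to every
    larger \<open>r\<close>.\<close>
  also have "\<dots> \<le> (w r - 1) / r\<^sup>2"
    unfolding w_def using quotient_mono[OF a0 R(1) _ r(2) va] R by simp
  finally have "1 + A * t ^ 4 * r\<^sup>2 \<le> w r"
    using R by (simp add: pos_le_divide_eq mult_ac)
  moreover have "1 + A * t ^ 4 * r\<^sup>2 > 0" using A0 t by (simp add: add_pos_nonneg)
  ultimately have "w r powr (- (real n - 2) / 2) \<le> (1 + A * t ^ 4 * r\<^sup>2) powr (- (real n - 2) / 2)"
    using n by (intro powr_mono2') auto
  moreover have "w r powr (- (real n - 2) / 2) = v r / v a"
  proof -
    have "- 2 / (real n - 2) * (- (real n - 2) / 2) = 1" using n by (simp add: field_simps)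
    then show ?thesis
      unfolding w_def powr_powr using solD(2)[OF rI] va by simp
  qed
  ultimately show ?thesis
    using va by (simp add: A_def pos_divide_le_eq mult.commute)
qed

section \<open>Reduction to rays\<close>

lemma partial_deriv_line:
  fixes u :: "'a::euclidean_space \<Rightarrow> real"
  assumes "u differentiable (at (x + t *\<^sub>R b))"
  shows "((\<lambda>t. u (x + t *\<^sub>R b)) has_real_derivative partial_deriv b u (x + t *\<^sub>R b)) (at t)"
proof -
  let ?y = "x + t *\<^sub>R b" and ?D = "frechet_derivative u (at (x + t *\<^sub>R b))"
  have D: "(u has_derivative ?D) (at ?y)"
    using assms frechet_derivative_works by blast
  have "((\<lambda>t. x + t *\<^sub>R b) has_derivative (\<lambda>h. h *\<^sub>R b)) (at t)"
    by (auto intro!: derivative_eq_intros)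
  from has_derivative_compose[OF this D]
  have "((\<lambda>t. u (x + t *\<^sub>R b)) has_derivative (\<lambda>h. ?D (h *\<^sub>R b))) (at t)" .
  moreover have "?D (h *\<^sub>R b) = partial_deriv b u ?y * h" for h
    using linear_scale[OF has_derivative_linear[OF D], of h b]
    by (simp add: partial_deriv_def mult.commute)
  ultimately show ?thesis by (simp add: has_field_derivative_def)
qed

lemma C2_on_line:
  fixes u :: "'a::euclidean_space \<Rightarrow> real"
  assumes "C2_on S u" "open S" "b \<in> Basis" "x + t *\<^sub>R b \<in> S"
  shows "((\<lambda>t. u (x + t *\<^sub>R b)) has_real_derivative partial_deriv b u (x + t *\<^sub>R b)) (at t)"
    and "((\<lambda>t. partial_deriv b u (x + t *\<^sub>R b)) has_real_derivative
      partial_deriv b (partial_deriv b u) (x + t *\<^sub>R b)) (at t)"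
proof -
  have "u differentiable_on S" "partial_deriv b u differentiable_on S"
    using assms(1,3) by (auto simp: C2_on_def)
  then have "u differentiable (at (x + t *\<^sub>R b))"
    "partial_deriv b u differentiable (at (x + t *\<^sub>R b))"
    using assms(2,4) by (metis at_within_open differentiable_on_def)+
  then show "((\<lambda>t. u (x + t *\<^sub>R b)) has_real_derivative partial_deriv b u (x + t *\<^sub>R b)) (at t)"
    and "((\<lambda>t. partial_deriv b u (x + t *\<^sub>R b)) has_real_derivative
      partial_deriv b (partial_deriv b u) (x + t *\<^sub>R b)) (at t)"
    by (auto intro: partial_deriv_line)
qed

text \<open>Unlike \<open>profile\<close>, this also applies to partial derivatives, which are not
  radial, and it extends to negative \<open>r\<close>, so that derivatives at \<open>0\<close> are
  two-sided.\<close>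

definition ray :: "('a::euclidean_space \<Rightarrow> real) \<Rightarrow> 'a \<Rightarrow> real \<Rightarrow> real" where
  "ray u e r = u (r *\<^sub>R e)"

lemma radial_eq_ray:
  assumes "radial u" "e \<in> Basis" "norm x \<le> 1"
  shows "u x = ray u e (norm x)"
proof -
  have "norm (norm x *\<^sub>R e) = norm x" using assms(2) by simp
  then show ?thesis
    using assms(1,3) unfolding radial_def ray_def by (metis mem_cball_0)
qed

lemma profile_eq_ray:
  fixes u :: "'a::euclidean_space \<Rightarrow> real"
  assumes "radial u" "e \<in> Basis" "0 \<le> r" "r \<le> 1"
  shows "profile u r = ray u e r"
  unfolding profile_def
proof (rule the_equality)
  show "\<forall>x. norm x = r \<longrightarrow> u x = ray u e r"
    using radial_eq_ray[OF assms(1,2)] assms(4) by auto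
next
  fix c assume "\<forall>x. norm x = r \<longrightarrow> u x = c"
  moreover have "norm (r *\<^sub>R e) = r" using assms by simp
  ultimately show "c = ray u e r" by (simp add: ray_def)
qed

lemma ray_deriv:
  assumes "C2_on (ball 0 1) u" "e \<in> Basis" "\<bar>r\<bar> < 1"
  shows "(ray u e has_real_derivative ray (partial_deriv e u) e r) (at r)"
    and "(ray (partial_deriv e u) e has_real_derivative
          ray (partial_deriv e (partial_deriv e u)) e r) (at r)"
proof -
  have "0 + r *\<^sub>R e \<in> ball 0 1" using assms(2,3) by simp
  from C2_on_line[OF assms(1) open_ball assms(2) this]
  show "(ray u e has_real_derivative ray (partial_deriv e u) e r) (at r)"
    and "(ray (partial_deriv e u) e has_real_derivative
          ray (partial_deriv e (partial_deriv e u)) e r) (at r)"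
    by (simp_all add: ray_def[abs_def])
qed

text \<open>Along the orthogonal direction \<open>b\<close>, \<open>u\<close> is its profile at
  \<open>\<rho> t = sqrt (r\<^sup>2 + t\<^sup>2)\<close>, with first derivative
  \<open>?U' (\<rho> t) * (t / \<rho> t)\<close>. At \<open>t = 0\<close> the product rule keeps
  only the derivative of \<open>t / \<rho> t\<close>, which is \<open>1 / r\<close>.\<close>

lemma radial_second_partial:
  fixes u :: "'a::euclidean_space \<Rightarrow> real"
  assumes C2: "C2_on (ball 0 1) u" and rad: "radial u"
    and e: "e \<in> Basis" and b: "b \<in> Basis" "b \<noteq> e" and r: "0 < r" "r < 1"
  shows "partial_deriv b (partial_deriv b u) (r *\<^sub>R e) = ray (partial_deriv e u) e r / r"
proof -
  let ?U = "ray u e" and ?U' = "ray (partial_deriv e u) e"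
  define \<rho> where "\<rho> t = sqrt (r\<^sup>2 + t\<^sup>2)" for t :: real
  have nrm: "norm (r *\<^sub>R e + t *\<^sub>R b) = \<rho> t" for t
  proof -
    have "e \<bullet> b = 0" using e b by (metis inner_not_same_Basis)
    then have "(norm (r *\<^sub>R e + t *\<^sub>R b))\<^sup>2 = r\<^sup>2 + t\<^sup>2"
      unfolding power2_norm_eq_inner using e b
      by (simp add: inner_add inner_commute power2_eq_square)
    then show ?thesis by (simp add: \<rho>_def real_sqrt_unique[symmetric])
  qed
  have \<rho>0: "\<rho> 0 = r" using r by (simp add: \<rho>_def)
  have \<rho>pos: "\<rho> t > 0" for t using r by (simp add: \<rho>_def add_pos_nonneg)
  have D\<rho>: "(\<rho> has_real_derivative t / \<rho> t) (at t)" for t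
  proof -
    have "r\<^sup>2 + t\<^sup>2 > 0" using r by (simp add: add_pos_nonneg)
    then show ?thesis
      unfolding \<rho>_def[abs_def] by (auto intro!: derivative_eq_intros simp: divide_simps)
  qed
  \<comment> \<open>Radial symmetry is known only in the ball, so the identities hold near
    \<open>t\<close> and not globally.\<close>
  have "open {t. \<rho> t < 1}"
    unfolding \<rho>_def[abs_def] by (intro open_Collect_less continuous_intros)
  then have ev: "eventually (\<lambda>t. \<rho> t < 1) (nhds t)" if "\<rho> t < 1" for t
    using eventually_nhds_in_open[of "{t. \<rho> t < 1}" t] that by simp
  have first: "partial_deriv b u (r *\<^sub>R e + t *\<^sub>R b) = ?U' (\<rho> t) * (t / \<rho> t)" if "\<rho> t < 1" for t
  proof (rule DERIV_unique)
    show "((\<lambda>t. u (r *\<^sub>R e + t *\<^sub>R b)) has_real_derivative partial_deriv b u (r *\<^sub>R e + t *\<^sub>R b)) (at t)"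
      using C2_on_line(1)[OF C2 open_ball b(1), of "r *\<^sub>R e" t] nrm that by simp
    have "((\<lambda>t. ?U (\<rho> t)) has_real_derivative ?U' (\<rho> t) * (t / \<rho> t)) (at t)"
      using ray_deriv(1)[OF C2 e, of "\<rho> t"] \<rho>pos[of t] that
      by (intro DERIV_chain2[where f = ?U and g = \<rho>] D\<rho>) auto
    moreover note ev[OF that]
    then have "eventually (\<lambda>t. ?U (\<rho> t) = u (r *\<^sub>R e + t *\<^sub>R b)) (nhds t)"
      by eventually_elim (use radial_eq_ray[OF rad e] nrm in auto)
    ultimately show "((\<lambda>t. u (r *\<^sub>R e + t *\<^sub>R b)) has_real_derivative ?U' (\<rho> t) * (t / \<rho> t)) (at t)"
      by (simp add: DERIV_cong_ev)
  qed
  have "((\<lambda>t. partial_deriv b u (r *\<^sub>R e + t *\<^sub>R b)) has_real_derivative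
      partial_deriv b (partial_deriv b u) (r *\<^sub>R e + 0 *\<^sub>R b)) (at 0)"
    using C2_on_line(2)[OF C2 open_ball b(1), of "r *\<^sub>R e" 0] r e by simp
  moreover have "eventually (\<lambda>t. partial_deriv b u (r *\<^sub>R e + t *\<^sub>R b) = ?U' (\<rho> t) * (t / \<rho> t)) (nhds 0)"
    using eventually_mono[OF ev[of 0] first] \<rho>0 r by simp
  ultimately have D1: "((\<lambda>t. ?U' (\<rho> t) * (t / \<rho> t)) has_real_derivative
      partial_deriv b (partial_deriv b u) (r *\<^sub>R e + 0 *\<^sub>R b)) (at 0)"
    by (simp add: DERIV_cong_ev)
  have D2: "((\<lambda>t. ?U' (\<rho> t)) has_real_derivative ray (partial_deriv e (partial_deriv e u)) e (\<rho> 0) * (0 / \<rho> 0)) (at 0)"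
    using ray_deriv(2)[OF C2 e, of "\<rho> 0"] r \<rho>0
    by (intro DERIV_chain2[where f = ?U' and g = \<rho>] D\<rho>) auto
  have "((\<lambda>t. ?U' (\<rho> t) * (t / \<rho> t)) has_real_derivative ?U' r / r) (at 0)"
    using r \<rho>0 D2 D\<rho>[of 0] by (auto intro!: derivative_eq_intros)
  with D1 show ?thesis using DERIV_unique by fastforce
qed

lemma laplacian_radial:
  fixes u :: "'a::euclidean_space \<Rightarrow> real"
  assumes C2: "C2_on (ball 0 1) u" and rad: "radial u"
    and e: "e \<in> Basis" and r: "0 < r" "r < 1"
  shows "laplacian u (r *\<^sub>R e) = ray (partial_deriv e (partial_deriv e u)) e r
      + (real DIM('a) - 1) / r * ray (partial_deriv e u) e r"
proof -
  have "laplacian u (r *\<^sub>R e) = partial_deriv e (partial_deriv e u) (r *\<^sub>R e)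
      + (\<Sum>b\<in>Basis - {e}. partial_deriv b (partial_deriv b u) (r *\<^sub>R e))"
    unfolding laplacian_def using e by (simp add: sum.remove)
  also have "(\<Sum>b\<in>Basis - {e}. partial_deriv b (partial_deriv b u) (r *\<^sub>R e))
      = (\<Sum>b\<in>Basis - {e}. ray (partial_deriv e u) e r / r)"
    using radial_second_partial[OF C2 rad e _ _ r] by (intro sum.cong) auto
  also have "\<dots> = (real DIM('a) - 1) / r * ray (partial_deriv e u) e r"
    using e by (simp add: card_Diff_singleton of_nat_diff Suc_leI)
  finally show ?thesis by (simp add: ray_def)
qed

section \<open>Positivity of the first eigenvalue\<close>

lemma second_deriv_nonpos_at_max:
  fixes g g' :: "real \<Rightarrow> real"
  assumes d: "d > 0" and g: "\<And>t. \<bar>t\<bar> < d \<Longrightarrow> (g has_real_derivative g' t) (at t)"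
    and g': "(g' has_real_derivative l) (at 0)" and max: "\<And>t. \<bar>t\<bar> < d \<Longrightarrow> g t \<le> g 0"
  shows "l \<le> 0"
proof (rule ccontr)
  assume "\<not> l \<le> 0"
  have g0: "g' 0 = 0"
    using DERIV_local_max[of g "g' 0" 0 d] g[of 0] d max by auto
  obtain \<epsilon> where \<epsilon>: "\<epsilon> > 0" "\<And>h. \<lbrakk>h > 0; h < \<epsilon>\<rbrakk> \<Longrightarrow> g' 0 < g' (0 + h)"
    using DERIV_pos_inc_right[OF g'] \<open>\<not> l \<le> 0\<close> by auto
  define t where "t = min \<epsilon> d / 2"
  have t: "0 < t" "t < \<epsilon>" "t < d" using \<epsilon>(1) d by (auto simp: t_def min_def)
  have "g 0 < g t"
  proof (rule DERIV_pos_imp_increasing_open[where f = g])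
    fix x assume "0 < x" "x < t"
    then show "\<exists>y. (g has_real_derivative y) (at x) \<and> 0 < y"
      using g[of x] \<epsilon>(2)[of x] t g0 by (intro exI[of _ "g' x"]) auto
  next
    show "continuous_on {0..t} g"
    proof (intro continuous_at_imp_continuous_on ballI)
      fix x assume "x \<in> {0..t}"
      then show "isCont g x" using g[of x] t DERIV_isCont by auto
    qed
  qed (fact t(1))
  moreover have "g t \<le> g 0" using t by (intro max) simp
  ultimately show False by simp
qed

text \<open>Comparison with the positive function \<open>2 - |x|\<^sup>2\<close>, whose Laplacian is \<open>-2 DIM('a)\<close>.\<close>

lemma dirichlet_eigenvalue_ge:
  assumes "dirichlet_eigenvalue TYPE('a::euclidean_space) \<mu>"
  shows "real DIM('a) \<le> \<mu>"
proof -
  obtain \<phi> :: "'a \<Rightarrow> real" where D: "dirichlet_C2 \<phi>" and nz: "\<exists>x\<in>ball 0 1. \<phi> x \<noteq> 0"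
    and eq: "\<And>x. x \<in> ball 0 1 \<Longrightarrow> - laplacian \<phi> x = \<mu> * \<phi> x"
    using assms unfolding dirichlet_eigenvalue_def by blast
  have C2: "C2_on (ball 0 1) \<phi>" and cont: "continuous_on (cball 0 1) \<phi>"
    and bd: "\<And>x. norm x = 1 \<Longrightarrow> \<phi> x = 0"
    using D by (auto simp: dirichlet_C2_def)
  define W where "W x = 2 - x \<bullet> x" for x :: 'a
  have W: "W x \<ge> 1" if "norm x \<le> 1" for x
    using that by (simp add: W_def power_le_one flip: power2_norm_eq_inner)
  have "continuous_on (cball 0 1) (\<lambda>x. \<bar>\<phi> x\<bar> / W x)"
    using W cont unfolding W_def by (fastforce intro!: continuous_intros)
  from continuous_attains_sup[OF compact_cball _ this]
  obtain x0 where x0: "x0 \<in> cball 0 1"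
    and max: "\<And>x. x \<in> cball 0 1 \<Longrightarrow> \<bar>\<phi> x\<bar> / W x \<le> \<bar>\<phi> x0\<bar> / W x0"
    by auto
  define K where "K = \<bar>\<phi> x0\<bar> / W x0"
  obtain y where y: "y \<in> ball 0 1" "\<phi> y \<noteq> 0" using nz by blast
  have "0 < \<bar>\<phi> y\<bar> / W y" using y W[of y] by auto
  also have "\<dots> \<le> K" unfolding K_def using max y by auto
  finally have K: "K > 0" .
  \<comment> \<open>The sign makes \<open>\<sigma> * \<phi>\<close> positive at \<open>x0\<close>;
    then \<open>\<sigma> * \<phi> - K * W\<close> attains its maximum \<open>0\<close>
    there.\<close>
  define \<sigma> where "\<sigma> = sgn (\<phi> x0)"
  have \<phi>x0: "\<sigma> * \<phi> x0 = K * W x0"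
    using W[of x0] x0 by (simp add: \<sigma>_def K_def mult_sgn_abs sgn_mult_self_eq abs_sgn mult.commute)
  have x0b: "norm x0 < 1"
    using bd[of x0] x0 K by (cases "norm x0 = 1") (auto simp: K_def)
  have le: "\<sigma> * \<phi> x - K * W x \<le> 0" if "norm x \<le> 1" for x
  proof -
    have "\<sigma> * \<phi> x \<le> \<bar>\<phi> x\<bar>"
      by (auto simp: \<sigma>_def sgn_if)
    also have "\<dots> \<le> K * W x"
      using max[of x] that W[OF that] by (simp add: K_def pos_divide_le_eq)
    finally show ?thesis by simp
  qed
  have "\<sigma> * partial_deriv b (partial_deriv b \<phi>) x0 + 2 * K \<le> 0" if b: "b \<in> Basis" for b
  proof (rule second_deriv_nonpos_at_max[where
      g = "\<lambda>t. \<sigma> * \<phi> (x0 + t *\<^sub>R b) - K * W (x0 + t *\<^sub>R b)" and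
      g' = "\<lambda>t. \<sigma> * partial_deriv b \<phi> (x0 + t *\<^sub>R b) - K * (- 2 * (x0 \<bullet> b + t))"])
    define d where "d = 1 - norm x0"
    show "d > 0" using x0b by (simp add: d_def)
    have inb: "norm (x0 + t *\<^sub>R b) < 1" if "\<bar>t\<bar> < d" for t
    proof -
      have "norm (x0 + t *\<^sub>R b) \<le> norm x0 + \<bar>t\<bar>"
        using norm_triangle_ineq[of x0 "t *\<^sub>R b"] b by simp
      then show ?thesis using that by (simp add: d_def)
    qed
    have DW: "((\<lambda>t. W (x0 + t *\<^sub>R b)) has_real_derivative - 2 * (x0 \<bullet> b + t)) (at t)" for t
    proof -
      have "W (x0 + t *\<^sub>R b) = 2 - (x0 \<bullet> x0 + 2 * (x0 \<bullet> b) * t + t * t)" for t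
        using b by (simp add: W_def inner_add inner_commute algebra_simps)
      then show ?thesis by (auto intro!: derivative_eq_intros)
    qed
    show "((\<lambda>t. \<sigma> * \<phi> (x0 + t *\<^sub>R b) - K * W (x0 + t *\<^sub>R b)) has_real_derivative
        (\<sigma> * partial_deriv b \<phi> (x0 + t *\<^sub>R b) - K * (- 2 * (x0 \<bullet> b + t)))) (at t)" if "\<bar>t\<bar> < d" for t
      using inb[OF that] by (intro DERIV_diff DERIV_cmult DW C2_on_line(1)[OF C2 _ b]) auto
    show "\<sigma> * \<phi> (x0 + t *\<^sub>R b) - K * W (x0 + t *\<^sub>R b) \<le> \<sigma> * \<phi> (x0 + 0 *\<^sub>R b) - K * W (x0 + 0 *\<^sub>R b)"
      if "\<bar>t\<bar> < d" for t
      using le[of "x0 + t *\<^sub>R b"] inb[OF that] \<phi>x0 by simp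
    have D2: "((\<lambda>t. partial_deriv b \<phi> (x0 + t *\<^sub>R b)) has_real_derivative
        partial_deriv b (partial_deriv b \<phi>) x0) (at 0)"
      using C2_on_line(2)[OF C2 open_ball b, of x0 0] x0b by simp
    show "((\<lambda>t. \<sigma> * partial_deriv b \<phi> (x0 + t *\<^sub>R b) - K * (- 2 * (x0 \<bullet> b + t))) has_real_derivative
        \<sigma> * partial_deriv b (partial_deriv b \<phi>) x0 + 2 * K) (at 0)"
      by (auto intro!: derivative_eq_intros D2)
  qed
  then have "(\<Sum>b\<in>Basis. \<sigma> * partial_deriv b (partial_deriv b \<phi>) x0 + 2 * K) \<le> 0"
    by (intro sum_nonpos) auto
  then have "\<sigma> * laplacian \<phi> x0 + real DIM('a) * (2 * K) \<le> 0"
    by (simp add: laplacian_def sum.distrib sum_distrib_left)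
  moreover have "laplacian \<phi> x0 = - (\<mu> * \<phi> x0)" using eq[of x0] x0b by simp
  ultimately have *: "real DIM('a) * (2 * K) \<le> \<mu> * (K * W x0)"
    using \<phi>x0 by (simp add: algebra_simps)
  then have *: "2 * real DIM('a) \<le> \<mu> * W x0" using K by (simp add: algebra_simps)
  \<comment> \<open>Positivity of \<open>\<mu>\<close> allows \<open>W x0\<close> to be replaced by
    its upper bound \<open>2\<close>.\<close>
  have "\<mu> > 0"
  proof (rule ccontr)
    assume "\<not> \<mu> > 0"
    then have "\<mu> * W x0 \<le> 0" using W[of x0] x0 by (simp add: mult_nonpos_nonneg)
    with * show False using DIM_positive[where 'a = 'a] by linarith
  qed
  then have "\<mu> * W x0 \<le> \<mu> * 2" by (intro mult_left_mono) (auto simp: W_def)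
  with * show ?thesis by simp
qed

section \<open>A Dirichlet eigenfunction from a Bessel series\<close>

text \<open>The recursion comes from inserting a power series into
  \<open>t * J'' + N * J' + J / 4 = 0\<close>.\<close>

fun bessel_coeff :: "real \<Rightarrow> nat \<Rightarrow> real" where
  "bessel_coeff N 0 = 1"
| "bessel_coeff N (Suc k) = - bessel_coeff N k / (4 * (real k + 1) * (real k + N))"

text \<open>With \<open>N = n / 2\<close>, the function \<open>bessel_sum N (\<mu> |x|\<^sup>2)\<close> is the radial solution of
  \<open>- \<Delta> \<phi> = \<mu> \<phi>\<close> in dimension \<open>n\<close> with \<open>\<phi> 0 = 1\<close>.\<close>

definition bessel_sum :: "real \<Rightarrow> real \<Rightarrow> real" where
  "bessel_sum N t = (\<Sum>k. bessel_coeff N k * t ^ k)"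

lemma bessel_coeff_bound:
  assumes "N \<ge> 1"
  shows "\<bar>bessel_coeff N k\<bar> \<le> 1 / fact k"
proof (induction k)
  case (Suc k)
  have "1 * (real k + 1) \<le> (4 * (real k + N)) * (real k + 1)"
    using assms by (intro mult_right_mono) auto
  also have "\<dots> = 4 * (real k + 1) * (real k + N)" by (simp only: mult_ac)
  finally have "\<bar>bessel_coeff N k\<bar> / (4 * (real k + 1) * (real k + N)) \<le> \<bar>bessel_coeff N k\<bar> / (real k + 1)"
    using assms by (intro divide_left_mono) auto
  also have "\<dots> \<le> (1 / fact k) / (real k + 1)"
    using Suc by (intro divide_right_mono) auto
  finally show ?case using assms by (simp add: abs_mult field_simps)
qed simp

lemma summable_bessel:
  assumes "N \<ge> 1"
  shows "summable (\<lambda>k. bessel_coeff N k * t ^ k)"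
proof (rule summable_comparison_test')
  show "summable (\<lambda>k. \<bar>t\<bar> ^ k / fact k)"
    using summable_exp_generic[of "\<bar>t\<bar>"] by (simp add: divide_inverse mult.commute)
  show "norm (bessel_coeff N k * t ^ k) \<le> \<bar>t\<bar> ^ k / fact k" if "k \<ge> 0" for k
    using mult_right_mono[OF bessel_coeff_bound[OF assms, of k], of "\<bar>t\<bar> ^ k"]
    by (simp add: abs_mult power_abs)
qed

lemma bessel_ode:
  assumes N: "N \<ge> 1"
  obtains J' J'' where
    "\<And>t. (bessel_sum N has_real_derivative J' t) (at t)"
    "\<And>t. (J' has_real_derivative J'' t) (at t)"
    "continuous_on UNIV J''"
    "\<And>t. t * J'' t + N * J' t + bessel_sum N t / 4 = 0"
proof -
  define c where "c = bessel_coeff N"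
  note S0 = summable_bessel[OF N, folded c_def]
  have S1: "summable (\<lambda>k. diffs c k * t ^ k)" for t
    by (rule termdiff_converges_all[OF S0])
  have S2: "summable (\<lambda>k. diffs (diffs c) k * t ^ k)" for t
    by (rule termdiff_converges_all[OF S1])
  \<comment> \<open>The third series makes \<open>J''\<close> differentiable and hence
    continuous.\<close>
  have S3: "summable (\<lambda>k. diffs (diffs (diffs c)) k * t ^ k)" for t
    by (rule termdiff_converges_all[OF S2])
  define J' where "J' t = (\<Sum>k. diffs c k * t ^ k)" for t
  define J'' where "J'' t = (\<Sum>k. diffs (diffs c) k * t ^ k)" for t
  have D0: "(bessel_sum N has_real_derivative J' t) (at t)" for t
    unfolding bessel_sum_def[abs_def] J'_def c_def[symmetric]
    by (rule termdiffs_strong_converges_everywhere[OF S0])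
  have D1: "(J' has_real_derivative J'' t) (at t)" for t
    unfolding J'_def[abs_def] J''_def
    by (rule termdiffs_strong_converges_everywhere[OF S1])
  have D2: "(J'' has_real_derivative (\<Sum>k. diffs (diffs (diffs c)) k * t ^ k)) (at t)" for t
    unfolding J''_def[abs_def] by (rule termdiffs_strong_converges_everywhere[OF S2])
  have "continuous_on UNIV J''"
    using D2 DERIV_isCont by (blast intro: continuous_at_imp_continuous_on)
  moreover have "t * J'' t + N * J' t + bessel_sum N t / 4 = 0" for t
  proof -
    have "(\<lambda>k. real k * diffs c k * t ^ k) sums (t * J'' t)"
    proof -
      have "(\<lambda>k. t * (diffs (diffs c) k * t ^ k)) sums (t * J'' t)"
        unfolding J''_def by (intro sums_mult summable_sums S2)
      then have "(\<lambda>k. real (Suc k) * diffs c (Suc k) * t ^ Suc k) sums (t * J'' t)"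
        by (simp add: diffs_def mult_ac)
      \<comment> \<open>The index shift costs nothing because the term with \<open>k = 0\<close> is
        zero.\<close>
      then show ?thesis
        by (subst (asm) sums_Suc_iff) simp
    qed
    moreover have "(\<lambda>k. N * (diffs c k * t ^ k)) sums (N * J' t)"
      unfolding J'_def by (intro sums_mult summable_sums S1)
    moreover have "(\<lambda>k. c k * t ^ k / 4) sums (bessel_sum N t / 4)"
      unfolding bessel_sum_def c_def[symmetric] by (intro sums_divide summable_sums S0)
    ultimately have "(\<lambda>k. real k * diffs c k * t ^ k + N * (diffs c k * t ^ k) + c k * t ^ k / 4)
        sums (t * J'' t + N * J' t + bessel_sum N t / 4)"
      by (intro sums_add)
    moreover have "real k * diffs c k * t ^ k + N * (diffs c k * t ^ k) + c k * t ^ k / 4 = 0" for k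
    proof -
      have "(real k + N) * diffs c k = - c k / 4"
        using N by (simp add: diffs_def c_def divide_simps)
      then have "((real k + N) * diffs c k + c k / 4) * t ^ k = 0" by simp
      then show ?thesis by (simp add: algebra_simps)
    qed
    ultimately show ?thesis using sums_unique2[OF _ sums_zero] by simp
  qed
  ultimately show ?thesis using that D0 D1 by blast
qed

text \<open>If there were no zero, the Wronskian of \<open>bessel_sum N\<close> with the test function \<open>(T - t)\<^sup>2\<close>
  would vanish at \<open>0\<close> and \<open>T\<close> but increase in between; \<open>T\<close> is chosen such that a
  quadratic polynomial in \<open>T - t\<close> has negative discriminant.\<close>

lemma bessel_zero:
  assumes N: "N \<ge> 1"
  shows "\<exists>t>0. bessel_sum N t = 0"
proof (rule ccontr)
  assume "\<not> (\<exists>t>0. bessel_sum N t = 0)"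
  then have nz: "bessel_sum N t \<noteq> 0" if "t > 0" for t using that by blast
  obtain J' J'' where
    DJ: "\<And>t. (bessel_sum N has_real_derivative J' t) (at t)"
    and DJ': "\<And>t. (J' has_real_derivative J'' t) (at t)"
    and ode: "\<And>t. t * J'' t + N * J' t + bessel_sum N t / 4 = 0"
    using bessel_ode[OF N] by metis
  let ?J = "bessel_sum N"
  have J0: "?J 0 = 1" by (simp add: bessel_sum_def)
  have contJ: "continuous_on UNIV ?J"
    using DJ DERIV_isCont by (blast intro: continuous_at_imp_continuous_on)
  have contJ': "continuous_on UNIV J'"
    using DJ' DERIV_isCont by (blast intro: continuous_at_imp_continuous_on)
  have pos: "?J t > 0" if "t > 0" for t
  proof (rule ccontr)
    assume "\<not> ?J t > 0"
    then have "\<exists>x\<ge>0. x \<le> t \<and> ?J x = 0"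
      using that J0 continuous_on_subset[OF contJ]
      by (intro IVT2') auto
    then show False using nz J0 by (metis less_eq_real_def zero_neq_one)
  qed
  \<comment> \<open>Completing the square in \<open>T - t\<close> below leaves the constant
    \<open>2 * T - 4 * (N + 1)\<^sup>2\<close>, positive for this \<open>T\<close>.\<close>
  define T where "T = 4 * (N + 1)\<^sup>2"
  have T: "T > 0" using N by (simp add: T_def)
  \<comment> \<open>The weight \<open>t powr N\<close> puts the equation in self-adjoint form, so
    \<open>J''\<close> and \<open>J'\<close> drop out of the derivative.\<close>
  define W where "W t = t powr N * (?J t * (- 2 * (T - t)) - (T - t)\<^sup>2 * J' t)" for t
  have "W 0 < W T"
  proof (rule DERIV_pos_imp_increasing_open[where f = W])
    fix t assume t: "0 < t" "t < T"
    have "(W has_real_derivative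
        N * t powr (N - 1) * (?J t * (- 2 * (T - t)) - (T - t)\<^sup>2 * J' t)
        + t powr N * (2 * ?J t - (T - t)\<^sup>2 * J'' t)) (at t)"
      unfolding W_def[abs_def]
      by (rule derivative_eq_intros DJ DJ' refl t(1) | simp add: algebra_simps)+
    also have "t powr N = t powr (N - 1) * t"
      using t powr_mult_base[of t "N - 1"] by (simp add: mult.commute)
    also have "N * t powr (N - 1) * (?J t * (- 2 * (T - t)) - (T - t)\<^sup>2 * J' t)
        + t powr (N - 1) * t * (2 * ?J t - (T - t)\<^sup>2 * J'' t)
      = t powr (N - 1) * (?J t * (2 * t - 2 * N * (T - t) + (T - t)\<^sup>2 / 4)
          - (T - t)\<^sup>2 * (t * J'' t + N * J' t + ?J t / 4))"
      by (simp add: algebra_simps)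
    also have "\<dots> = t powr (N - 1) * (?J t * (2 * t - 2 * N * (T - t) + (T - t)\<^sup>2 / 4))"
      by (simp only: ode) simp
    finally have D: "(W has_real_derivative
        t powr (N - 1) * (?J t * (2 * t - 2 * N * (T - t) + (T - t)\<^sup>2 / 4))) (at t)" .
    have "2 * t - 2 * N * (T - t) + (T - t)\<^sup>2 / 4 = ((T - t) / 2 - 2 * (N + 1))\<^sup>2 + 2 * T - 4 * (N + 1)\<^sup>2"
      by (simp add: power2_eq_square field_simps)
    also have "\<dots> > 0"
      using T zero_le_power2[of "(T - t) / 2 - 2 * (N + 1)"] unfolding T_def by linarith
    finally show "\<exists>y. (W has_real_derivative y) (at t) \<and> 0 < y"
      using D pos[OF t(1)] t(1) by (intro exI conjI) (assumption, simp)
  next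
    show "continuous_on {0..T} W"
      unfolding W_def[abs_def] using N
      by (intro continuous_intros continuous_on_powr' continuous_on_subset[OF contJ] continuous_on_subset[OF contJ']) auto
  qed (use T in simp)
  then show False by (simp add: W_def)
qed

text \<open>A positive zero \<open>\<mu>\<close> of \<open>bessel_sum N\<close> makes the radial
  function vanish on the unit sphere and serves as its eigenvalue. Using
  \<open>x \<bullet> x\<close> keeps the function smooth at the origin.\<close>

lemma exists_dirichlet_eigenvalue:
  assumes "DIM('a::euclidean_space) \<ge> 2"
  shows "\<exists>\<mu>. dirichlet_eigenvalue TYPE('a) \<mu>"
proof -
  define N where "N = real DIM('a) / 2"
  have N: "N \<ge> 1" using assms by (simp add: N_def)
  obtain J' J'' where
    DJ: "\<And>t. (bessel_sum N has_real_derivative J' t) (at t)"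
    and DJ': "\<And>t. (J' has_real_derivative J'' t) (at t)"
    and contJ'': "continuous_on UNIV J''"
    and ode: "\<And>t. t * J'' t + N * J' t + bessel_sum N t / 4 = 0"
    using bessel_ode[OF N] by metis
  let ?J = "bessel_sum N"
  obtain \<mu> where \<mu>: "\<mu> > 0" "?J \<mu> = 0" using bessel_zero[OF N] by blast
  define \<phi> where "\<phi> x = ?J (\<mu> * (x \<bullet> x))" for x :: 'a
  have chain: "((\<lambda>x::'a. g (\<mu> * (x \<bullet> x))) has_derivative (\<lambda>h. g' (\<mu> * (x \<bullet> x)) * (2 * \<mu> * (x \<bullet> h)))) (at x)"
    if "\<And>t. (g has_real_derivative g' t) (at t)" for g g' x
  proof -
    have "((\<lambda>x::'a. \<mu> * (x \<bullet> x)) has_derivative (\<lambda>h. 2 * \<mu> * (x \<bullet> h))) (at x)"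
      by (auto intro!: derivative_eq_intros simp: inner_commute algebra_simps)
    from has_derivative_compose[OF this, of g, OF that[unfolded has_field_derivative_def]]
    show ?thesis .
  qed
  have D1: "partial_deriv b \<phi> x = 2 * \<mu> * (J' (\<mu> * (x \<bullet> x)) * (x \<bullet> b))" for b x
    unfolding partial_deriv_def
    using frechet_derivative_at[OF chain[OF DJ, of x, folded \<phi>_def], symmetric] by simp
  have d1: "\<phi> differentiable (at x within S)" for x S
    using chain[OF DJ, of x, folded \<phi>_def] differentiable_at_withinI differentiableI by blast
  have d2: "((partial_deriv b \<phi>) has_derivative (\<lambda>h. 2 * \<mu> * (J' (\<mu> * (x \<bullet> x)) * (h \<bullet> b)
      + J'' (\<mu> * (x \<bullet> x)) * (2 * \<mu> * (x \<bullet> h)) * (x \<bullet> b)))) (at x)" for b x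
    unfolding D1[abs_def]
    by (auto intro!: derivative_eq_intros chain[OF DJ'])
  have D2: "partial_deriv c (partial_deriv b \<phi>) x = 2 * \<mu> * (J' (\<mu> * (x \<bullet> x)) * (c \<bullet> b)
      + J'' (\<mu> * (x \<bullet> x)) * (2 * \<mu> * (x \<bullet> c)) * (x \<bullet> b))" for b c x
    unfolding partial_deriv_def[of c]
    using frechet_derivative_at[OF d2[of b x], symmetric] by simp
  have contJ': "continuous_on UNIV J'"
    using DJ' DERIV_isCont by (blast intro: continuous_at_imp_continuous_on)
  have "C2_on (ball 0 1) \<phi>"
    unfolding C2_on_def
  proof (intro conjI ballI)
    show "\<phi> differentiable_on ball 0 1" using d1 by (simp add: differentiable_on_def)
    show "partial_deriv b \<phi> differentiable_on ball 0 1" for b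
      unfolding differentiable_on_def
      using differentiable_at_withinI[OF differentiableI[OF d2]] by blast
    show "continuous_on (ball 0 1) (partial_deriv c (partial_deriv b \<phi>))" for b c
      unfolding D2[abs_def]
      by (intro continuous_intros continuous_on_compose2[OF contJ'] continuous_on_compose2[OF contJ'']) auto
  qed
  moreover have "continuous_on (cball 0 1) \<phi>"
    using d1 by (intro differentiable_imp_continuous_on) (simp add: differentiable_on_def)
  moreover have "\<phi> x = 0" if "x \<in> sphere 0 1" for x
    using that \<mu>(2) by (simp add: \<phi>_def flip: power2_norm_eq_inner)
  ultimately have "dirichlet_C2 \<phi>" by (simp add: dirichlet_C2_def)
  moreover have "\<phi> 0 \<noteq> 0" by (simp add: \<phi>_def bessel_sum_def)
  then have "\<exists>x\<in>ball 0 1. \<phi> x \<noteq> 0" by (intro bexI[of _ 0]) auto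
  moreover have "- laplacian \<phi> x = \<mu> * \<phi> x" for x
  proof -
    have "laplacian \<phi> x = 2 * \<mu> * (J' (\<mu> * (x \<bullet> x)) * real DIM('a)
        + J'' (\<mu> * (x \<bullet> x)) * (2 * \<mu> * (x \<bullet> x)))"
    proof -
      have "laplacian \<phi> x = (\<Sum>b\<in>Basis. 2 * \<mu> * (J' (\<mu> * (x \<bullet> x))
          + J'' (\<mu> * (x \<bullet> x)) * (2 * \<mu>) * ((x \<bullet> b) * (x \<bullet> b))))"
        unfolding laplacian_def D2 by (intro sum.cong) (auto simp: algebra_simps)
      also have "\<dots> = 2 * \<mu> * (J' (\<mu> * (x \<bullet> x)) * real DIM('a)
          + J'' (\<mu> * (x \<bullet> x)) * (2 * \<mu>) * (\<Sum>b\<in>Basis. (x \<bullet> b) * (x \<bullet> b)))"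
        by (simp add: sum_distrib_left sum.distrib algebra_simps)
      also have "(\<Sum>b\<in>Basis. (x \<bullet> b) * (x \<bullet> b)) = x \<bullet> x"
        by (rule euclidean_inner[symmetric])
      finally show ?thesis by (simp add: algebra_simps)
    qed
    also have "\<dots> = 4 * \<mu> * (\<mu> * (x \<bullet> x) * J'' (\<mu> * (x \<bullet> x)) + N * J' (\<mu> * (x \<bullet> x)))"
      by (simp add: N_def algebra_simps)
    also have "\<dots> = - (\<mu> * \<phi> x)"
    proof -
      have "\<mu> * (x \<bullet> x) * J'' (\<mu> * (x \<bullet> x)) + N * J' (\<mu> * (x \<bullet> x)) = - (\<phi> x / 4)"
        using ode[of "\<mu> * (x \<bullet> x)"] by (simp add: \<phi>_def)
      then show ?thesis by simp
    qed
    finally show ?thesis by simp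
  qed
  ultimately show ?thesis unfolding dirichlet_eigenvalue_def by blast
qed

text \<open>Existence of an eigenvalue ensures that the \<open>Inf\<close> is taken over a nonempty
  set; otherwise the lower bound would say nothing about it.\<close>

lemma first_eigenvalue_pos:
  assumes "DIM('a::euclidean_space) \<ge> 2"
  shows "first_eigenvalue TYPE('a) > 0"
proof -
  have "real DIM('a) \<le> first_eigenvalue TYPE('a)"
    unfolding first_eigenvalue_def
    using exists_dirichlet_eigenvalue[OF assms] dirichlet_eigenvalue_ge
    by (intro cInf_greatest) auto
  then show ?thesis using DIM_positive[where 'a = 'a] by linarith
qed

section \<open>Solutions with two nodal regions\<close>

lemma bn_solution_ray_deriv:
  fixes u :: "'a::euclidean_space \<Rightarrow> real"
  assumes n: "n = DIM('a)" "n \<ge> 3" and sol: "bn_solution lam u" and rad: "radial u"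
    and e: "e \<in> Basis" and r: "0 < r" "r < 1"
  shows "(ray (partial_deriv e u) e has_real_derivative
    - ((real n - 1) / r * ray (partial_deriv e u) e r
       + (lam * ray u e r + \<bar>ray u e r\<bar> powr (4 / (real n - 2)) * ray u e r))) (at r)"
proof -
  have C2: "C2_on (ball 0 1) u" using sol by (simp add: bn_solution_def dirichlet_C2_def)
  have "crit_exp n - 2 = 4 / (real n - 2)"
    using n by (simp add: crit_exp_def field_simps)
  moreover have "r *\<^sub>R e \<in> ball 0 1" using r e by simp
  ultimately have "- laplacian u (r *\<^sub>R e)
      = lam * ray u e r + \<bar>ray u e r\<bar> powr (4 / (real n - 2)) * ray u e r"
    using sol n by (simp add: bn_solution_def ray_def)
  then have "ray (partial_deriv e (partial_deriv e u)) e r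
      = - ((real n - 1) / r * ray (partial_deriv e u) e r
       + (lam * ray u e r + \<bar>ray u e r\<bar> powr (4 / (real n - 2)) * ray u e r))"
    using laplacian_radial[OF C2 rad e r] n by simp
  then show ?thesis
    using ray_deriv(2)[OF C2 e, of r] r by simp
qed

text \<open>The nonlinearity is odd, so the sign \<open>\<sigma>\<close> treats both nodal regions
  at once.\<close>

lemma bn_solution_radial_pos:
  fixes u :: "'a::euclidean_space \<Rightarrow> real"
  assumes n: "n = DIM('a)" "n \<ge> 3" and sol: "bn_solution lam u" and rad: "radial u"
    and e: "e \<in> Basis" and I: "I \<subseteq> {0<..<1}" and \<sigma>: "\<sigma> \<in> {1, -1}"
    and pos: "\<And>r. r \<in> I \<Longrightarrow> \<sigma> * ray u e r > 0"
  shows "radial_pos_solution n lam I (\<lambda>r. \<sigma> * ray u e r) (\<lambda>r. \<sigma> * ray (partial_deriv e u) e r)"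
  unfolding radial_pos_solution_def
proof (intro ballI conjI)
  fix r assume r: "r \<in> I"
  then have r01: "0 < r" "r < 1" using I by auto
  show "0 < r" by (fact r01)
  show "0 < \<sigma> * ray u e r" by (rule pos[OF r])
  have C2: "C2_on (ball 0 1) u" using sol by (simp add: bn_solution_def dirichlet_C2_def)
  show "((\<lambda>r. \<sigma> * ray u e r) has_real_derivative \<sigma> * ray (partial_deriv e u) e r) (at r)"
    using ray_deriv(1)[OF C2 e, of r] r01 by (intro DERIV_cmult) auto
  have "\<bar>ray u e r\<bar> = \<sigma> * ray u e r" using \<sigma> pos[OF r] by auto
  then have f: "bn_f n lam (\<sigma> * ray u e r)
      = \<sigma> * (lam * ray u e r + \<bar>ray u e r\<bar> powr (4 / (real n - 2)) * ray u e r)"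
    using pos[OF r] n by (simp add: bn_f_altdef algebra_simps)
  have "\<sigma> * - ((real n - 1) / r * ray (partial_deriv e u) e r
       + (lam * ray u e r + \<bar>ray u e r\<bar> powr (4 / (real n - 2)) * ray u e r))
      = - ((real n - 1) / r * (\<sigma> * ray (partial_deriv e u) e r) + bn_f n lam (\<sigma> * ray u e r))"
    unfolding f by (simp add: algebra_simps)
  then show "((\<lambda>r. \<sigma> * ray (partial_deriv e u) e r) has_real_derivative
      - ((real n - 1) / r * (\<sigma> * ray (partial_deriv e u) e r) + bn_f n lam (\<sigma> * ray u e r))) (at r)"
    using DERIV_cmult[OF bn_solution_ray_deriv[OF n sol rad e r01], of \<sigma>] by simp
qed

text \<open>The Pohozaev function is followed from the centre to the node and then to the minimum of
  \<open>u\<close>, where \<open>pohozaev_critical_point\<close> converts its smallness into the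
  third claim.\<close>

lemma two_nodal_region_estimate:
  fixes u :: "'a::euclidean_space \<Rightarrow> real"
  assumes n: "n = DIM('a)" "n \<ge> 3" and lam: "lam > 0"
    and sol: "bn_solution lam u" and rad: "radial u" and e: "e \<in> Basis"
    and R: "0 < R" "R < s" and s: "s < 1"
    and pos: "\<And>x. norm x < R \<Longrightarrow> u x > 0"
    and neg: "\<And>x. \<lbrakk>R < norm x; norm x < 1\<rbrakk> \<Longrightarrow> u x < 0"
    and min: "\<And>r. r \<in> {0..1} \<Longrightarrow> ray u e s \<le> ray u e r"
  defines "v \<equiv> \<lambda>r. - ray u e r"
  shows "radial_decreasing_solution n lam s 1 v (\<lambda>r. - ray (partial_deriv e u) e r)"
    and "v s > 0"
    and "v s powr (4 / (real n - 2)) * s\<^sup>2 \<le> (real n / (real n - 2) * bubble_const n * lam) powr (2 / real n)"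
proof -
  have C2: "C2_on (ball 0 1) u" using sol by (simp add: bn_solution_def dirichlet_C2_def)
  define V where "V = ray u e"
  define V' where "V' = ray (partial_deriv e u) e"
  have v: "v = (\<lambda>r. - V r)" by (simp add: v_def V_def)
  have DV: "(V has_real_derivative V' r) (at r)" if "\<bar>r\<bar> < 1" for r
    using ray_deriv(1)[OF C2 e that] by (simp add: V_def V'_def)
  have "isCont V r" "isCont V' r" if "\<bar>r\<bar> < 1" for r
    using ray_deriv[OF C2 e that] DERIV_isCont unfolding V_def V'_def by blast+
  then have cont: "continuous_on S V" "continuous_on S V'" if "S \<subseteq> {0..<1}" for S
    using that by (auto intro!: continuous_at_imp_continuous_on)
  have Vpos: "V r > 0" if "0 \<le> r" "r < R" for r
    using pos[of "r *\<^sub>R e"] that e by (simp add: V_def ray_def)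
  have Vneg: "V r < 0" if "R < r" "r < 1" for r
    using neg[of "r *\<^sub>R e"] that e R by (simp add: V_def ray_def)
  \<comment> \<open>There is a zero between \<open>0\<close> and \<open>s\<close>, and the strict
    signs on both sides leave only \<open>R\<close>.\<close>
  have VR: "V R = 0"
  proof -
    have "\<exists>x\<ge>0. x \<le> s \<and> V x = 0"
      using Vpos[of 0] Vneg[of s] R s by (intro IVT2' cont) auto
    then show ?thesis using Vpos Vneg s by (metis less_le_not_le less_linear order_le_less_trans)
  qed
  show vs: "v s > 0" using Vneg[of s] R s by (simp add: v)
  have V's: "V' s = 0"
  proof (rule DERIV_local_min[OF DV])
    show "\<bar>s\<bar> < 1" "min s (1 - s) > 0" using R s by auto
    show "\<forall>y. \<bar>s - y\<bar> < min s (1 - s) \<longrightarrow> V s \<le> V y"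
      unfolding V_def by (intro allI impI min) (auto simp: abs_less_iff)
  qed
  have inner: "radial_pos_solution n lam {0<..<R} V V'"
    using bn_solution_radial_pos[OF n sol rad e, of "{0<..<R}" 1] Vpos R s
    by (simp add: V_def V'_def subset_iff)
  have outer: "radial_pos_solution n lam {R<..<1} v (\<lambda>r. - V' r)"
    using bn_solution_radial_pos[OF n sol rad e, of "{R<..<1}" "-1"] Vneg R s
    by (simp add: v V_def V'_def subset_iff)
  show "radial_decreasing_solution n lam s 1 v (\<lambda>r. - ray (partial_deriv e u) e r)"
    unfolding V'_def[symmetric]
  proof
    show "radial_pos_solution n lam {s<..<1} v (\<lambda>r. - V' r)"
      using outer R by (auto simp: radial_pos_solution_def)
    show "continuous_on {s..<1} v" "continuous_on {s..<1} (\<lambda>r. - V' r)"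
      unfolding v using R by (auto intro!: continuous_on_minus cont)
  qed (use n lam R V's in auto)
  interpret inner: radial_decreasing_solution n lam 0 R V V'
  proof (rule radial_decreasing_solution.intro)
    show "n \<ge> 3" "radial_pos_solution n lam {0<..<R} V V'" by fact+
    show "lam \<ge> 0" "(0::real) \<le> 0" using lam by simp_all
    show "continuous_on {0..<R} V" "continuous_on {0..<R} V'"
      using R s by (auto intro!: cont)
    show "0 ^ (n - 1) * V' 0 = 0" using n(2) by simp
  qed
  have "pohozaev n lam v (\<lambda>r. - V' r) s \<le> pohozaev n lam v (\<lambda>r. - V' r) R"
  proof (rule pohozaev_node_to_max)
    show "radial_pos_solution n lam {R<..<s} v (\<lambda>r. - V' r)"
      using outer s by (auto simp: radial_pos_solution_def)
    show "continuous_on {R..s} v" "continuous_on {R..s} (\<lambda>r. - V' r)"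
      unfolding v using R s by (auto intro!: continuous_on_minus cont)
    show "v r \<le> v s" if "r \<in> {R..s}" for r
      using min[of r] that R s by (simp add: v_def)
  qed (use n lam R VR in \<open>auto simp: v\<close>)
  \<comment> \<open>At the node only the square of the derivative survives, which is blind to the
    change of sign.\<close>
  also have "\<dots> = pohozaev n lam V V' R" by (simp add: pohozaev_def v VR)
  also have "\<dots> \<le> lam * bubble_const n / 2 * R\<^sup>2"
    using Vpos[of 0] R s VR by (intro inner.pohozaev_node cont) auto
  also have "\<dots> \<le> lam * bubble_const n / 2 * 1"
    using R s lam by (intro mult_left_mono) (auto simp: bubble_const_def power_le_one)
  finally have "pohozaev n lam v (\<lambda>r. - V' r) s \<le> lam * (bubble_const n / 2)" by simp
  then have "v s powr (4 / (real n - 2)) * s\<^sup>2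
      \<le> (2 * real n / (real n - 2) * (bubble_const n / 2) * lam) powr (2 / real n)"
    by (rule pohozaev_critical_point[where v' = "\<lambda>r. - V' r", rotated -1])
      (use n(2) lam R vs V's in linarith)+
  also have "2 * real n / (real n - 2) * (bubble_const n / 2) * lam
      = real n / (real n - 2) * bubble_const n * lam" using n(2) by (simp add: field_simps)
  finally show "v s powr (4 / (real n - 2)) * s\<^sup>2
      \<le> (real n / (real n - 2) * bubble_const n * lam) powr (2 / real n)" .
qed

lemma powr_small:
  fixes C D q :: real
  assumes "C > 0" "D > 0" "q > 0"
  shows "\<exists>L>0. \<forall>lam\<in>{0<..<L}. lam + (C * lam) powr q \<le> D"
\<comment> \<open>Each summand is allotted \<open>D / 2\<close>.\<close>
proof (intro exI[of _ "min (D / 2) ((D / 2) powr (1 / q) / C)"] conjI ballI)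
  fix lam assume lam: "lam \<in> {0<..<min (D / 2) ((D / 2) powr (1 / q) / C)}"
  then have "C * lam \<le> (D / 2) powr (1 / q)" using assms by (simp add: field_simps)
  then have "(C * lam) powr q \<le> ((D / 2) powr (1 / q)) powr q"
    using lam assms by (intro powr_mono2) auto
  also have "\<dots> = D / 2" using assms by (simp add: powr_powr)
  finally show "lam + (C * lam) powr q \<le> D" using lam by simp
next
  show "min (D / 2) ((D / 2) powr (1 / q) / C) > 0" using assms by simp
qed

theorem proposition7:
  fixes u :: "real \<Rightarrow> 'a::euclidean_space \<Rightarrow> real"
    and rn s :: "real \<Rightarrow> real"
    and lam1 :: real and n :: nat
  assumes n_def: "n = DIM('a)" and n_ge: "n \<ge> 7"
    and lam1_def: "lam1 = first_eigenvalue TYPE('a)"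
    and least: "\<And>lam. lam \<in> {0<..<lam1} \<Longrightarrow> least_energy_radial_sc lam (u lam)"
    and pos0: "\<And>lam. lam \<in> {0<..<lam1} \<Longrightarrow> u lam 0 > 0"
    and node: "\<And>lam. lam \<in> {0<..<lam1} \<Longrightarrow> rn lam \<in> {0<..<1}"
    and node_pos: "\<And>lam x. \<lbrakk>lam \<in> {0<..<lam1}; norm x < rn lam\<rbrakk> \<Longrightarrow> u lam x > 0"
    and node_neg: "\<And>lam x. \<lbrakk>lam \<in> {0<..<lam1}; rn lam < norm x; norm x < 1\<rbrakk> \<Longrightarrow> u lam x < 0"
    and s_range: "\<And>lam. lam \<in> {0<..<lam1} \<Longrightarrow> s lam \<in> {rn lam<..<1}"
    and s_min: "\<And>lam r. \<lbrakk>lam \<in> {0<..<lam1}; r \<in> {0..1}\<rbrakk>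
                  \<Longrightarrow> profile (u lam) (s lam) \<le> profile (u lam) r"
  shows "\<exists>(\<delta> :: real \<Rightarrow> real) (lambar :: real \<Rightarrow> real).
           (\<delta> \<longlongrightarrow> 1) (at_right 0) \<and>
           (\<forall>\<epsilon>\<in>{0<..<(real n - 2) / 2}.
              \<delta> \<epsilon> \<in> {0<..<1} \<and> 0 < lambar \<epsilon> \<and> lambar \<epsilon> \<le> lam1 \<and>
              (\<forall>lam\<in>{0<..<lambar \<epsilon>}. \<forall>x.
                 let M = neg_part (profile (u lam)) (s lam);
                     c = 2 / (real n - 2) * \<epsilon>
                 in \<delta> \<epsilon> powr (- 1 / real n) * s lam < norm x \<and> norm x < 1 \<longrightarrow>
                    neg_part (u lam) x
                      \<le> M * (1 + (bn_f n lam M / M) / (real n * (real n - 2)) * c * (norm x)\<^sup>2)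
                              powr (- (real n - 2) / 2)))"
proof -
  have n3: "n \<ge> 3" using n_ge by simp
  obtain e :: 'a where e: "e \<in> Basis" using nonempty_Basis by blast
  have lam1: "lam1 > 0" using first_eigenvalue_pos[where 'a = 'a] n_def n_ge lam1_def by simp
  \<comment> \<open>Since \<open>t \<epsilon> ^ 4\<close> is the constant \<open>c\<close> of the
    claim, the range of \<open>\<epsilon>\<close> is exactly where
    \<open>0 < t \<epsilon> < 1\<close>.\<close>
  define t where "t \<epsilon> = (2 / (real n - 2) * \<epsilon>) powr (1 / 4)" for \<epsilon>
  \<comment> \<open>The exponent \<open>n\<close> makes the inner radius of the annulus
    \<open>s / (1 - t \<epsilon>)\<close>.\<close>
  define \<delta> where "\<delta> \<epsilon> = (1 - t \<epsilon>) ^ n" for \<epsilon>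
  \<comment> \<open>The smallness threshold of \<open>bubble_upper_bound\<close>.\<close>
  define D where "D \<epsilon> = real n * (real n - 2) * (2 * (1 - (t \<epsilon>)\<^sup>2) * (1 - t \<epsilon>)\<^sup>2 / t \<epsilon> ^ 6)" for \<epsilon>
  define C where "C = real n / (real n - 2) * bubble_const n"
  have C: "C > 0" using n_ge by (simp add: C_def bubble_const_def)
  have t: "0 < t \<epsilon>" "t \<epsilon> < 1" "t \<epsilon> ^ 4 = 2 / (real n - 2) * \<epsilon>" if \<epsilon>: "\<epsilon> \<in> {0<..<(real n - 2) / 2}" for \<epsilon>
  proof -
    have c: "0 < 2 / (real n - 2) * \<epsilon>" "2 / (real n - 2) * \<epsilon> < 1"
      using \<epsilon> n_ge by (auto simp: field_simps)
    show t0: "0 < t \<epsilon>" using \<epsilon> n_ge by (simp add: t_def)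
    have "t \<epsilon> ^ 4 = t \<epsilon> powr 4" using t0 by simp
    also have "\<dots> = (2 / (real n - 2) * \<epsilon>) powr 1"
      unfolding t_def powr_powr by simp
    also have "\<dots> = 2 / (real n - 2) * \<epsilon>"
      by (rule powr_one) (use c in linarith)
    finally show t4: "t \<epsilon> ^ 4 = 2 / (real n - 2) * \<epsilon>" .
    show "t \<epsilon> < 1"
      using c t4 by (metis not_le one_le_power)
  qed
  have "\<exists>L>0. \<forall>lam\<in>{0<..<L}. lam + (C * lam) powr (2 / real n) \<le> D \<epsilon>"
    if \<epsilon>: "\<epsilon> \<in> {0<..<(real n - 2) / 2}" for \<epsilon>
  proof (rule powr_small)
    have "(t \<epsilon>)\<^sup>2 < 1" using t(1,2)[OF \<epsilon>] by (simp add: power_less_one_iff)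
    then show "D \<epsilon> > 0" using t[OF \<epsilon>] n_ge by (simp add: D_def)
  qed (use C n_ge in auto)
  then obtain L where L: "\<And>\<epsilon>. \<epsilon> \<in> {0<..<(real n - 2) / 2} \<Longrightarrow> L \<epsilon> > 0"
    "\<And>\<epsilon> lam. \<lbrakk>\<epsilon> \<in> {0<..<(real n - 2) / 2}; lam \<in> {0<..<L \<epsilon>}\<rbrakk> \<Longrightarrow> lam + (C * lam) powr (2 / real n) \<le> D \<epsilon>"
    by metis
  \<comment> \<open>Capped by \<open>lam1\<close>, below which the hypotheses on the family
    hold.\<close>
  define lambar where "lambar \<epsilon> = min lam1 (L \<epsilon>)" for \<epsilon>
  show ?thesis
  proof (rule exI[of _ \<delta>], rule exI[of _ lambar], rule conjI, goal_cases)
    case 1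
    have "((\<lambda>\<epsilon>. 2 / (real n - 2) * \<epsilon>) \<longlongrightarrow> 2 / (real n - 2) * 0) (at_right 0)"
      by (intro tendsto_intros)
    \<comment> \<open>The base of the power tends to \<open>0\<close>, so the limit rule asks for
      eventual nonnegativity.\<close>
    moreover have "eventually (\<lambda>\<epsilon>. 2 / (real n - 2) * \<epsilon> \<ge> 0) (at_right 0)"
      unfolding eventually_at_right_field using n_ge by (intro exI[of _ 1]) auto
    ultimately have "(t \<longlongrightarrow> (2 / (real n - 2) * 0) powr (1 / 4)) (at_right 0)"
      unfolding t_def[abs_def] by (intro tendsto_powr') auto
    then have "(t \<longlongrightarrow> 0) (at_right 0)" by simp
    then have "(\<delta> \<longlongrightarrow> (1 - 0) ^ n) (at_right 0)"
      unfolding \<delta>_def[abs_def] by (intro tendsto_intros)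
    then show ?case by simp
  next
    case 2
    show ?case
    proof (rule ballI, goal_cases)
      case (1 \<epsilon>)
      then have \<epsilon>: "\<epsilon> \<in> {0<..<(real n - 2) / 2}" by simp
      note t = t[OF \<epsilon>]
      have \<delta>01: "\<delta> \<epsilon> \<in> {0<..<1}"
        using t n_ge by (simp add: \<delta>_def power_less_one_iff)
      have lb: "0 < lambar \<epsilon>" "lambar \<epsilon> \<le> lam1"
        using lam1 L(1)[OF \<epsilon>] by (auto simp: lambar_def)
      show ?case
      proof (intro conjI \<delta>01 lb, intro ballI allI, goal_cases)
        case (1 lam x)
        then have lamE: "lam \<in> {0<..<lambar \<epsilon>}" by simp
        then have lam': "lam \<in> {0<..<lam1}" and lam0: "lam > 0" by (auto simp: lambar_def)
        have sol: "bn_solution lam (u lam)" and rad: "radial (u lam)"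
          using least[OF lam'] by (auto simp: least_energy_radial_sc_def radial_sc_solution_def)
        define S where "S = s lam"
        have R: "0 < rn lam" "rn lam < S" and S: "S < 1"
          using node[OF lam'] s_range[OF lam'] by (auto simp: S_def)
        have S0: "S > 0" using R by simp
        have prof: "profile (u lam) r = ray (u lam) e r" if "r \<in> {0..1}" for r
          using profile_eq_ray[OF rad e] that by simp
        have min: "ray (u lam) e S \<le> ray (u lam) e r" if "r \<in> {0..1}" for r
          using s_min[OF lam' that] prof[OF that] prof[of S] S S0 by (simp add: S_def)
        define v where "v = (\<lambda>r. - ray (u lam) e r)"
        note est = two_nodal_region_estimate[OF n_def n3 lam0 sol rad e R S node_pos[OF lam']
            node_neg[OF lam'] min, folded v_def]
        interpret radial_decreasing_solution n lam S 1 v "\<lambda>r. - ray (partial_deriv e (u lam)) e r"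
          by (rule est(1))
        have vS: "v S > 0" using est(2) by (simp add: v_def)
        have M: "neg_part (profile (u lam)) (s lam) = v S"
          using vS prof[of S] S S0 by (simp add: neg_part_def v_def S_def)
        have h: "bn_f n lam (v S) / v S = lam + v S powr (4 / (real n - 2))"
          using vS n3 by (simp add: bn_f_altdef)
        have "(bn_f n lam (v S) / v S) * S\<^sup>2 = lam * S\<^sup>2 + v S powr (4 / (real n - 2)) * S\<^sup>2"
          unfolding h by (simp add: algebra_simps)
        also have "\<dots> \<le> lam * 1 + (C * lam) powr (2 / real n)"
        proof (intro add_mono mult_left_mono)
          show "v S powr (4 / (real n - 2)) * S\<^sup>2 \<le> (C * lam) powr (2 / real n)"
            using est(3) by (simp add: C_def v_def)
        qed (use S S0 lam0 in \<open>auto simp: power_le_one\<close>)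
        also have "\<dots> \<le> D \<epsilon>" using L(2)[OF \<epsilon>, of lam] lamE by (simp add: lambar_def)
        finally have small: "bn_f n lam (v S) / v S * S\<^sup>2 \<le> D \<epsilon>" .
        have \<delta>: "\<delta> \<epsilon> powr (- 1 / real n) * s lam = S / (1 - t \<epsilon>)"
        proof -
          have "\<delta> \<epsilon> = (1 - t \<epsilon>) powr real n" using t by (simp add: \<delta>_def powr_realpow)
          then have "\<delta> \<epsilon> powr (- 1 / real n) = (1 - t \<epsilon>) powr - 1"
            using n_ge by (simp add: powr_powr)
          also have "\<dots> = 1 / (1 - t \<epsilon>)" using t by (simp add: powr_minus_divide)
          finally show ?thesis by (simp add: S_def)
        qed
        show ?case
          unfolding Let_def M \<delta> t(3)[symmetric]
        proof (intro impI, elim conjE)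
          assume x: "S / (1 - t \<epsilon>) < norm x" "norm x < 1"
          \<comment> \<open>Points of the annulus lie beyond \<open>S\<close>, hence beyond the
            node.\<close>
          have "S \<le> S / (1 - t \<epsilon>)" using S0 t by (simp add: field_simps)
          then have "u lam x < 0" using node_neg[OF lam'] R x by simp
          then have "neg_part (u lam) x = v (norm x)"
            using radial_eq_ray[OF rad e, of x] x by (simp add: neg_part_def v_def)
          then show "neg_part (u lam) x \<le> v S * (1 + bn_f n lam (v S) / v S / (real n * (real n - 2))
              * t \<epsilon> ^ 4 * (norm x)\<^sup>2) powr (- (real n - 2) / 2)"
            using bubble_upper_bound[OF S0 vS t(1,2) small[unfolded D_def] x] by simp
        qed
      qed
    qed
  qed
qed

end
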